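(* Consider the minimization of $f(\mathbf{x})=-\log\det(X(\mathbf{x}))$ over the polytope $\mathcal{P}$ (the continuous relaxation of the D-Optimal Experiment Design Problem). The blended pairwise conditional gradient (BPCG) algorithm contracts the primal gap $h_t$ at a linear rate, $$h_t \leq h_0 \exp(-ct),$$ with $h_0$ the primal gap of the initial domain-feasible solution and $c>0$ a constant depending on the design matrix $A$ and the polytope $\mathcal{P}$.
   Context: $A\in\mathbb{R}^{m\times n}$ has full column rank, with rows $\mathbf{v}_1,\dots,\mathbf{v}_m\in\mathbb{R}^n$. $X(\mathbf{x}) := A^\intercal\operatorname{diag}(\mathbf{x})A=\sum_i x_i\mathbf{v}_i\mathbf{v}_i^\intercal$. $\mathcal{P} := [\mathbf{l},\mathbf{u}]\cap\{\mathbf{x}\in\mathbb{R}^m_{\ge 0} : \sum_{i=1}^m x_i = N\}$ with bounds $\mathbf{l}\le\mathbf{u}$ in $\mathbb{N}_0^m$ and a positive integer $N$. A point $\mathbf{x}\in\mathcal{P}$ is domain-feasible if $X(\mathbf{x})$ is positive definite; $f=+\infty$ at other points. The primal gap is $h_t=f(\mathbf{x}_t)-\min_{\mathbf{x}\in\mathcal{P}}f(\mathbf{x})$, where $\mathbf{x}_t$ are the iterates. BPCG: start from a domain-feasible $\mathbf{x}_0\in\mathcal{P}$ given as a convex combination, with positive weights, of the vertices in an active set $\mathcal{S}_0$. At step $t$, $\mathbf{x}_t$ is stored as a convex combination of the vertices in the active set $\mathcal{S}_t$ with positive weights. Compute $\mathbf{a}_t\in\operatorname{argmax}_{\mathbf{v}\in\mathcal{S}_t}\langle\nabla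 f(\mathbf{x}_t),\mathbf{v}\rangle$, $\mathbf{s}_t\in\operatorname{argmin}_{\mathbf{v}\in\mathcal{S}_t}\langle\nabla f(\mathbf{x}_t),\mathbf{v}\rangle$, and a vertex $\mathbf{w}_t\in\operatorname{argmin}_{\mathbf{v}\in \mathcal{P}}\langle\nabla f(\mathbf{x}_t),\mathbf{v}\rangle$. If $\langle\nabla f(\mathbf{x}_t),\mathbf{a}_t-\mathbf{s}_t\rangle\ge\langle\nabla f(\mathbf{x}_t),\mathbf{x}_t-\mathbf{w}_t\rangle$, take the local pairwise direction $\mathbf{d}_t=\mathbf{a}_t-\mathbf{s}_t$ with maximal step size equal to the weight of $\mathbf{a}_t$; otherwise take the Frank-Wolfe direction $\mathbf{d}_t=\mathbf{x}_t-\mathbf{w}_t$ with maximal step size $1$. Set $\mathbf{x}_{t+1}=\mathbf{x}_t-\gamma_t\mathbf{d}_t$ with $\gamma_t$ minimizing $f$ along the segment of admissible step sizes. In a pairwise step with maximal step size (drop step), $\mathbf{a}_t$ is removed from the active set; in a Frank-Wolfe step $\mathbf{w}_t$ is added to the active set (which becomes $\{\mathbf{w}_t\}$ if $\gamma_t=1$).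
   Formalization: The constant c depends, besides A and P, on a positive lower bound for the weights in the initial convex combination (for a start at a vertex, on A and P only); a first drop step of tiny weight rules out a c uniform over all initial domain-feasible solutions. *)

theory Defs
  imports "HOL-Analysis.Analysis"
begin

definition diag_mat :: "real^'m \<Rightarrow> real^'m^'m" where
  "diag_mat x = (\<chi> i j. if i = j then x $ i else 0)"

definition pos_def :: "real^'n^'n \<Rightarrow> bool" where
  "pos_def M \<longleftrightarrow> transpose M = M \<and> (\<forall>y. y \<noteq> 0 \<longrightarrow> 0 < y \<bullet> (M *v y))"

definition info_mat :: "real^'n^'m \<Rightarrow> real^'m \<Rightarrow> real^'n^'n" where
  "info_mat A x = transpose A ** diag_mat x ** A"

definition design_polytope :: "nat^'m \<Rightarrow> nat^'m \<Rightarrow> nat \<Rightarrow> (real^'m) set" where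
  "design_polytope l u N =
     cbox (\<chi> i. real (l $ i)) (\<chi> i. real (u $ i)) \<inter>
     {x. (\<forall>i. 0 \<le> x $ i) \<and> (\<Sum>i\<in>UNIV. x $ i) = real N}"

definition domain_feasible :: "real^'n^'m \<Rightarrow> (real^'m) set \<Rightarrow> real^'m \<Rightarrow> bool" where
  "domain_feasible A P x \<longleftrightarrow> x \<in> P \<and> pos_def (info_mat A x)"

definition logdet_obj :: "real^'n^'m \<Rightarrow> real^'m \<Rightarrow> real" where
  "logdet_obj A x = - ln (det (info_mat A x))"

definition dopt_obj :: "real^'n^'m \<Rightarrow> real^'m \<Rightarrow> ereal" where
  "dopt_obj A x = (if pos_def (info_mat A x) then ereal (logdet_obj A x) else \<infinity>)"

text \<open>The infimum is attained whenever \<open>P\<close> contains a domain-feasible point, because \<open>P\<close> is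
  compact and the extended-valued objective is lower semicontinuous.\<close>

definition primal_gap :: "real^'n^'m \<Rightarrow> (real^'m) set \<Rightarrow> real^'m \<Rightarrow> ereal" where
  "primal_gap A P x = dopt_obj A x - (INF y\<in>P. dopt_obj A y)"

text \<open>A state is a triple of the iterate, the active set and the weights.  Weights are total
  functions, equal to zero off the active set.  Initial weights may be arbitrarily small, and a
  drop step at a vertex of small weight makes correspondingly little progress; hence a
  contraction rate valid from step 0 can be uniform in the start only for starts whose weights
  have a common positive lower bound.  A start at a single vertex has weight 1.\<close>

type_synonym 'm bpcg_state = "(real^'m) \<times> (real^'m) set \<times> (real^'m \<Rightarrow> real)"

definition bpcg_start :: "real^'n^'m \<Rightarrow> (real^'m) set \<Rightarrow> 'm bpcg_state \<Rightarrow> bool" where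
  "bpcg_start A P = (\<lambda>(x, S, wt).
     domain_feasible A P x \<and>
     finite S \<and> (\<forall>v\<in>S. v extreme_point_of P) \<and>
     (\<forall>v\<in>S. 0 < wt v) \<and> (\<forall>v. v \<notin> S \<longrightarrow> wt v = 0) \<and>
     (\<Sum>v\<in>S. wt v) = 1 \<and> x = (\<Sum>v\<in>S. wt v *\<^sub>R v))"

definition line_search :: "real^'n^'m \<Rightarrow> real^'m \<Rightarrow> real^'m \<Rightarrow> real \<Rightarrow> real \<Rightarrow> bool" where
  "line_search A x d gmax \<gamma> \<longleftrightarrow>
     is_arg_min (\<lambda>r. dopt_obj A (x - r *\<^sub>R d)) (\<lambda>r. r \<in> {0..gmax}) \<gamma>"

text \<open>At iterates the extended-valued objective agrees with \<open>logdet_obj\<close> on a neighbourhood, so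
  \<open>g\<close> below is its gradient.  In a pairwise step \<open>a = s\<close> is possible only if the iterate is
  already optimal; the direction is then zero and the state is left unchanged.\<close>

inductive bpcg_step ::
    "real^'n^'m \<Rightarrow> (real^'m) set \<Rightarrow> 'm bpcg_state \<Rightarrow> 'm bpcg_state \<Rightarrow> bool"
  for A :: "real^'n^'m" and P :: "(real^'m) set" where
  pairwise:
    "bpcg_step A P (x, S, wt)
       (x - \<gamma> *\<^sub>R (a - s),
        if \<gamma> = wt a \<and> a \<noteq> s then S - {a} else S,
        \<lambda>v. wt v - (if v = a then \<gamma> else 0) + (if v = s then \<gamma> else 0))"
    if "GDERIV (logdet_obj A) x :> g"
      and "is_arg_max (\<lambda>v. g \<bullet> v) (\<lambda>v. v \<in> S) a"
      and "is_arg_min (\<lambda>v. g \<bullet> v) (\<lambda>v. v \<in> S) s"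
      and "w extreme_point_of P" and "is_arg_min (\<lambda>v. g \<bullet> v) (\<lambda>v. v \<in> P) w"
      and "g \<bullet> (a - s) \<ge> g \<bullet> (x - w)"
      and "line_search A x (a - s) (wt a) \<gamma>"
| frank_wolfe:
    "bpcg_step A P (x, S, wt)
       (x - \<gamma> *\<^sub>R (x - w),
        if \<gamma> = 1 then {w} else insert w S,
        \<lambda>v. (1 - \<gamma>) * wt v + (if v = w then \<gamma> else 0))"
    if "GDERIV (logdet_obj A) x :> g"
      and "is_arg_max (\<lambda>v. g \<bullet> v) (\<lambda>v. v \<in> S) a"
      and "is_arg_min (\<lambda>v. g \<bullet> v) (\<lambda>v. v \<in> S) s"
      and "w extreme_point_of P" and "is_arg_min (\<lambda>v. g \<bullet> v) (\<lambda>v. v \<in> P) w"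
      and "g \<bullet> (a - s) < g \<bullet> (x - w)"
      and "line_search A x (x - w) 1 \<gamma>"

definition bpcg_run ::
    "real^'n^'m \<Rightarrow> (real^'m) set \<Rightarrow> (nat \<Rightarrow> real^'m) \<Rightarrow> (nat \<Rightarrow> (real^'m) set) \<Rightarrow>
     (nat \<Rightarrow> real^'m \<Rightarrow> real) \<Rightarrow> bool" where
  "bpcg_run A P x S wt \<longleftrightarrow>
     bpcg_start A P (x 0, S 0, wt 0) \<and>
     (\<forall>t. bpcg_step A P (x t, S t, wt t) (x (Suc t), S (Suc t), wt (Suc t)))"

end

theory Submission
  imports Defs
begin

text \<open>
  The objective depends on \<open>x\<close> only through \<open>X(x)\<close>, and on a sublevel set within the polytope it is
  smooth in \<open>x\<close> and strongly convex in \<open>X(x)\<close>; both are read off from a simultaneous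
  diagonalization of \<open>X(x)\<close> and \<open>X(d)\<close>.  For \<open>x\<close> in the convex hull of an active set \<open>S\<close> and \<open>y\<close> in the
  polytope, \<open>x - y\<close> lies in the cone generated by the differences \<open>v - w\<close> with \<open>v \<in> S\<close> and \<open>w\<close> a
  vertex.  A Hoffman-type bound on the coefficients, taken in the seminorm \<open>\<bar>X(x - y)\<bar>\<close>, combines with
  strong convexity to give: primal gap \<open>\<le> K (g \<bullet> (a - w))\<^sup>2\<close>.  This replaces the pyramidal width, and no
  quadratic growth towards a minimizer is needed.  The BPCG direction realizes at least half of
  \<open>g \<bullet> (a - w)\<close>, so every step that is not a drop step contracts the gap by a fixed factor.  Drop
  steps are bounded by the number of vertices plus the number of other steps, and the lower bound
  \<open>\<delta>\<close> on the initial weights makes the very first step contract even if it is a drop step.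
\<close>

section \<open>Simultaneous diagonalization\<close>

text \<open>Two features of the objective shape the proof. It blows up at the boundary of its
  domain, so no smoothness constant is valid on the whole polytope; a lower bound \<alpha> for the
  form of X(x) takes over, and descent keeps the iterates where it holds. Moreover the linear map X
  may have a kernel, along which the objective is constant, so strong convexity can be measured only
  in X(x).

  The estimate has no factor in front of the initial gap, and one constant serves all starts with
  weights at least \<delta>. Hence \<alpha> itself must be uniform over an infinite family of
  starts. This is the second role of \<delta>: such a start is comparable, up to the factor
  \<delta>, with the plain sum of its active vertices, and only finitely many such sums exist.

  The optimal value enters as an infimum: estimates are made against an arbitrary comparison point
  and then passed to the infimum.\<close>

lemma inner_symmetric_matrix_commute:
  fixes M :: "real^'n^'n"
  assumes "transpose M = M"
  shows "a \<bullet> (M *v b) = b \<bullet> (M *v a)"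
  by (metis assms dot_lmul_matrix inner_commute transpose_matrix_vector)

lemma linear_coeff_zero_if_quadratic_nonneg:
  fixes b q :: real
  assumes "\<And>t. 0 \<le> 2 * t * b + t\<^sup>2 * q" "0 \<le> q"
  shows "b = 0"
proof (rule ccontr)
  assume "b \<noteq> 0"
  \<comment> \<open>The quadratic is minimal at \<open>- b / q\<close>; with \<open>q + 1\<close> in
    the denominator the point also makes sense for \<open>q = 0\<close>, and the value is still
    negative.\<close>
  have "2 * (- b / (q + 1)) * b + (- b / (q + 1))\<^sup>2 * q = - (b\<^sup>2 * (q + 2)) / (q + 1)\<^sup>2"
    using assms(2) by (simp add: divide_simps power2_eq_square) algebra
  moreover have "\<dots> < 0"
    using assms(2) \<open>b \<noteq> 0\<close> by (intro divide_neg_pos) auto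
  ultimately show False
    using assms(1)[of "- b / (q + 1)"] by linarith
qed

text \<open>This is the variational proof of the spectral theorem, relative to the inner product of
  \<open>X\<close>: the next vector maximizes the quotient of the two forms on the
  \<open>X\<close>-orthogonal complement \<open>W\<close> of the earlier ones. The induction runs
  over a set of indices, so that the finished basis is indexed by the type \<open>'n\<close>
  itself.\<close>

lemma generalized_eigenvectors_exist:
  fixes X D :: "real^'n^'n" and I :: "'n set"
  assumes X: "pos_def X" and D: "transpose D = D"
  shows "\<exists>c m. (\<forall>i\<in>I. \<forall>j\<in>I. c i \<bullet> (X *v c j) = (if i = j then 1 else 0)) \<and>
           (\<forall>i\<in>I. D *v c i = m i *\<^sub>R (X *v c i))"
  using finite[of I]
proof (induction I rule: finite_induct)
  case empty
  show ?case by simp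
next
  case (insert k I)
  have symX: "transpose X = X" and posX: "\<And>y. y \<noteq> 0 \<Longrightarrow> 0 < y \<bullet> (X *v y)"
    using X by (auto simp: pos_def_def)
  obtain c m where c: "\<And>i j. i \<in> I \<Longrightarrow> j \<in> I \<Longrightarrow> c i \<bullet> (X *v c j) = (if i = j then 1 else 0)"
    and m: "\<And>i. i \<in> I \<Longrightarrow> D *v c i = m i *\<^sub>R (X *v c i)"
    using insert.IH by blast
  define W where "W = {y. \<forall>i\<in>I. y \<bullet> (X *v c i) = 0}"
  \<comment> \<open>Since \<open>k\<close> lies outside \<open>I\<close>, fewer than
    \<open>CARD('n)\<close> linear conditions define \<open>W\<close>, which therefore contains a
    nonzero vector.\<close>
  have "card I < CARD('n)"
    using insert.hyps by (metis UNIV_I finite psubset_card_mono psubsetI subset_UNIV)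
  then have "dim (span ((\<lambda>i. X *v c i) ` I)) < DIM(real^'n)"
    using dim_le_card'[of "(\<lambda>i. X *v c i) ` I"] card_image_le[of I "\<lambda>i. X *v c i"]
    by (simp add: dim_span)
  then obtain y0 where y0: "y0 \<noteq> 0" "\<And>y. y \<in> span ((\<lambda>i. X *v c i) ` I) \<Longrightarrow> orthogonal y0 y"
    using orthogonal_to_subspace_exists[of "(\<lambda>i. X *v c i) ` I"] by (auto simp: dim_span)
  have y0W: "y0 \<in> W"
    unfolding W_def using y0(2) by (auto simp: orthogonal_def span_base)
  have W_scale: "r *\<^sub>R y \<in> W" if "y \<in> W" for r y
    using that by (auto simp: W_def)
  have W_add: "y + z \<in> W" if "y \<in> W" "z \<in> W" for y z
    using that by (auto simp: W_def inner_add_left)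
  have "W = (\<Inter>i\<in>I. {y. y \<bullet> (X *v c i) = 0})"
    by (auto simp: W_def)
  then have "closed W"
    by (auto intro!: closed_INT closed_Collect_eq continuous_intros)
  then have comp: "compact (sphere 0 1 \<inter> W)"
    by (intro compact_Int_closed) auto
  have "(1 / norm y0) *\<^sub>R y0 \<in> sphere 0 1 \<inter> W"
    using W_scale[OF y0W, of "1 / norm y0"] y0(1) by simp
  then have ne: "sphere 0 1 \<inter> W \<noteq> {}"
    by blast
  have nz: "y \<bullet> (X *v y) \<noteq> 0" if "y \<in> sphere 0 1 \<inter> W" for y
  proof -
    have "y \<noteq> 0" using that by auto
    then show ?thesis using posX[of y] by simp
  qed
  have cont: "continuous_on (sphere 0 1 \<inter> W) (\<lambda>y. (y \<bullet> (D *v y)) / (y \<bullet> (X *v y)))"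
    by (intro continuous_intros matrix_vector_mult_linear_continuous_on)
       (use nz in blast)
  obtain e where e: "e \<in> sphere 0 1 \<inter> W"
    and emax: "\<And>y. y \<in> sphere 0 1 \<inter> W \<Longrightarrow>
      (y \<bullet> (D *v y)) / (y \<bullet> (X *v y)) \<le> (e \<bullet> (D *v e)) / (e \<bullet> (X *v e))"
    using continuous_attains_sup[OF comp ne cont] by auto
  define M where "M = (e \<bullet> (D *v e)) / (e \<bullet> (X *v e))"
  \<comment> \<open>The form of \<open>Q\<close> is nonnegative on \<open>W\<close> and vanishes at
    the maximizer \<open>e\<close>. Expanding it at \<open>e + t *\<^sub>R y\<close> shows that
    \<open>Q *v e\<close> is orthogonal to \<open>W\<close>; it is orthogonal to the earlier
    eigenvectors as well, which forces \<open>Q *v e = 0\<close>.\<close>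
  define Q where "Q = M *\<^sub>R X - D"
  have eX: "0 < e \<bullet> (X *v e)" using e nz[of e] posX[of e] by fastforce
  have symQ: "transpose Q = Q"
    using symX D unfolding Q_def by (simp add: transpose_def vec_eq_iff)
  have Qv: "Q *v y = M *\<^sub>R (X *v y) - D *v y" for y
    unfolding Q_def by (simp add: matrix_vector_mult_diff_rdistrib scaleR_matrix_vector_assoc)
  have Qe: "e \<bullet> (Q *v e) = 0"
    unfolding Qv using eX by (simp add: inner_diff_right M_def)
  have Qnn: "0 \<le> y \<bullet> (Q *v y)" if y: "y \<in> W" for y
  proof (cases "y = 0")
    case False
    define z where "z = (1 / norm y) *\<^sub>R y"
    have z: "z \<in> sphere 0 1 \<inter> W" using False W_scale[OF y] by (auto simp: z_def)
    then have "0 < z \<bullet> (X *v z)" using nz[of z] posX[of z] by fastforce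
    then have "0 \<le> z \<bullet> (Q *v z)"
      using emax[OF z] unfolding M_def[symmetric] Qv by (simp add: inner_diff_right divide_simps)
    moreover have "y = norm y *\<^sub>R z" using False by (simp add: z_def)
    then have "y \<bullet> (Q *v y) = (norm y)\<^sup>2 * (z \<bullet> (Q *v z))"
      by (metis inner_scaleR_left inner_scaleR_right matrix_vector_mult_scaleR mult.assoc power2_eq_square)
    ultimately show ?thesis by simp
  qed auto
  have QeW: "y \<bullet> (Q *v e) = 0" if y: "y \<in> W" for y
  proof (rule linear_coeff_zero_if_quadratic_nonneg[OF _ Qnn[OF y]])
    fix t
    have "0 \<le> (e + t *\<^sub>R y) \<bullet> (Q *v (e + t *\<^sub>R y))"
      using Qnn W_add W_scale e y by blast
    also have "\<dots> = 2 * t * (y \<bullet> (Q *v e)) + t\<^sup>2 * (y \<bullet> (Q *v y))"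
      using inner_symmetric_matrix_commute[OF symQ, of e y] Qe
      by (simp add: matrix_vector_right_distrib inner_add_left inner_add_right
          matrix_vector_mult_scaleR power2_eq_square algebra_simps)
    finally show "0 \<le> 2 * t * (y \<bullet> (Q *v e)) + t\<^sup>2 * (y \<bullet> (Q *v y))" .
  qed
  have Qec: "c i \<bullet> (Q *v e) = 0" if i: "i \<in> I" for i
  proof -
    have "c i \<bullet> (Q *v e) = e \<bullet> (Q *v c i)" by (rule inner_symmetric_matrix_commute[OF symQ])
    also have "\<dots> = (M - m i) * (e \<bullet> (X *v c i))" by (simp add: Qv m[OF i] inner_diff_right algebra_simps)
    also have "\<dots> = 0" using e i by (simp add: W_def)
    finally show ?thesis .
  qed
  have "Q *v e = 0"
  proof -
    define y where "y = Q *v e"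
    \<comment> \<open>Subtracting the \<open>X\<close>-components along the earlier vectors moves
      \<open>Q *v e\<close> into \<open>W\<close>; by \<open>Qec\<close> this does not change the
      pairing with \<open>Q *v e\<close>.\<close>
    define w where "w = y - (\<Sum>i\<in>I. (y \<bullet> (X *v c i)) *\<^sub>R c i)"
    have "(\<Sum>j\<in>I. (y \<bullet> (X *v c j)) * (c j \<bullet> (X *v c i))) = y \<bullet> (X *v c i)" if "i \<in> I" for i
    proof -
      have "(\<Sum>j\<in>I. (y \<bullet> (X *v c j)) * (c j \<bullet> (X *v c i)))
          = (\<Sum>j\<in>I. if j = i then y \<bullet> (X *v c j) else 0)"
        using that c by (intro sum.cong) auto
      then show ?thesis using that insert.hyps by simp
    qed
    then have "w \<in> W"
      unfolding W_def w_def by (simp add: inner_diff_left inner_sum_left)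
    then have "w \<bullet> (Q *v e) = 0" by (rule QeW)
    moreover have "w \<bullet> (Q *v e) = y \<bullet> (Q *v e)"
      unfolding w_def by (simp add: inner_diff_left inner_sum_left Qec)
    ultimately show ?thesis by (simp add: y_def)
  qed
  then have De: "D *v e = M *\<^sub>R (X *v e)" by (simp add: Qv)
  define c' where "c' = c(k := (1 / sqrt (e \<bullet> (X *v e))) *\<^sub>R e)"
  have c'k: "c' k = (1 / sqrt (e \<bullet> (X *v e))) *\<^sub>R e" and c'I: "\<And>i. i \<in> I \<Longrightarrow> c' i = c i"
    using insert.hyps by (auto simp: c'_def)
  have kk: "c' k \<bullet> (X *v c' k) = 1"
    using eX by (simp add: c'k matrix_vector_mult_scaleR)
  have ki: "c' k \<bullet> (X *v c i) = 0" if "i \<in> I" for i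
    using e that by (simp add: c'k W_def)
  have ik: "c i \<bullet> (X *v c' k) = 0" if "i \<in> I" for i
    using ki[OF that] by (simp add: inner_symmetric_matrix_commute[OF symX])
  have orth: "c' i \<bullet> (X *v c' j) = (if i = j then 1 else 0)" if "i \<in> insert k I" "j \<in> insert k I" for i j
    using that insert.hyps c kk ki ik c'I by auto
  have "D *v c' i = (m(k := M)) i *\<^sub>R (X *v c' i)" if "i \<in> insert k I" for i
    using that insert.hyps m c'I De by (auto simp: c'k matrix_vector_mult_scaleR)
  with orth show ?case by blast
qed

lemma matrix_congruence_nth:
  "(R ** M ** transpose R) $ i $ j = R $ i \<bullet> (M *v (R $ j))" for R M :: "real^'n^'n"
proof -
  have "(R ** M ** transpose R) $ i $ j = (R ** (M ** transpose R)) $ i $ j"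
    by (simp add: matrix_mul_assoc)
  also have "\<dots> = R $ i \<bullet> (M *v (R $ j))"
    by (simp add: matrix_matrix_mult_def transpose_def inner_vec_def matrix_vector_mult_def)
  finally show ?thesis .
qed

text \<open>The rows of \<open>R\<close> are the generalized eigenvectors. The third equation is
  their completeness relation, from which every vector is expanded in these rows.\<close>

lemma simultaneous_diagonalization:
  fixes X D :: "real^'n^'n"
  assumes "pos_def X" and "transpose D = D"
  obtains R :: "real^'n^'n" and m :: "real^'n"
  where "R ** X ** transpose R = mat 1" "R ** D ** transpose R = diag_mat m"
    "transpose R ** (R ** X) = mat 1"
proof -
  obtain c :: "'n \<Rightarrow> real^'n" and m where c: "\<And>i j. c i \<bullet> (X *v c j) = (if i = j then 1 else 0)"
    and m: "\<And>i. D *v c i = m i *\<^sub>R (X *v c i)"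
    using generalized_eigenvectors_exist[OF assms, of UNIV] by auto
  define R :: "real^'n^'n" where "R = (\<chi> i. c i)"
  have 1: "R ** X ** transpose R = mat 1"
    by (simp add: vec_eq_iff matrix_congruence_nth R_def c mat_def)
  have 2: "R ** D ** transpose R = diag_mat (\<chi> i. m i)"
    by (simp add: vec_eq_iff matrix_congruence_nth R_def m c diag_mat_def)
  have 3: "transpose R ** (R ** X) = mat 1"
    using 1 matrix_left_right_inverse by blast
  show ?thesis using that[OF 1 2 3] .
qed

section \<open>The objective along a line\<close>

lemma diag_mat_mult_vector_nth: "(diag_mat x *v y) $ i = x $ i * y $ i"
  by (simp add: diag_mat_def matrix_vector_mult_def if_distrib[of "\<lambda>c. c * _"] cong: if_cong)

lemma inner_info_mat:
  "a \<bullet> (info_mat A x *v b) = (\<Sum>i\<in>UNIV. x $ i * ((A *v a) $ i * (A *v b) $ i))"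
proof -
  have "a \<bullet> (info_mat A x *v b) = (A *v a) \<bullet> (diag_mat x *v (A *v b))"
    unfolding info_mat_def matrix_vector_mul_assoc[symmetric]
    by (metis dot_lmul_matrix inner_commute transpose_matrix_vector)
  also have "\<dots> = (\<Sum>i\<in>UNIV. x $ i * ((A *v a) $ i * (A *v b) $ i))"
    by (simp add: inner_vec_def diag_mat_mult_vector_nth algebra_simps)
  finally show ?thesis .
qed

lemma transpose_info_mat [simp]: "transpose (info_mat A x) = info_mat A x"
proof -
  have "transpose (diag_mat x) = diag_mat x"
    by (auto simp: diag_mat_def transpose_def vec_eq_iff)
  then show ?thesis by (simp add: info_mat_def matrix_transpose_mul matrix_mul_assoc)
qed

lemma linear_info_mat: "linear (info_mat A)" for A :: "real^'n^'m"
proof (rule linearI)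
  fix x y :: "real^'m" and r :: real
  have eqI: "M = M'" if "\<And>a b. a \<bullet> (M *v b) = a \<bullet> (M' *v b)" for M M' :: "real^'n^'n"
  proof -
    have "M *v b = M' *v b" for b
      using that vector_eq_ldot by blast
    then show ?thesis
      using matrix_eq by blast
  qed
  show "info_mat A (x + y) = info_mat A x + info_mat A y"
    by (rule eqI) (simp add: matrix_vector_mult_add_rdistrib inner_add_right inner_info_mat
        distrib_right sum.distrib)
  show "info_mat A (r *\<^sub>R x) = r *\<^sub>R info_mat A x"
    by (rule eqI) (simp add: inner_info_mat sum_distrib_left mult.assoc flip: scaleR_matrix_vector_assoc)
qed

lemma inner_info_mat_add:
  "a \<bullet> (info_mat A (x + r *\<^sub>R d) *v b) = a \<bullet> (info_mat A x *v b) + r * (a \<bullet> (info_mat A d *v b))"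
  by (simp add: inner_info_mat sum_distrib_left algebra_simps flip: sum.distrib)

text \<open>The sum of absolute entries is the convenient size of \<open>x\<close> here, because it
  equals \<open>N\<close> throughout the design polytope.\<close>

lemma abs_inner_info_mat_le:
  "\<bar>a \<bullet> (info_mat A x *v b)\<bar> \<le> (\<Sum>i\<in>UNIV. \<bar>x $ i\<bar>) * (onorm ((*v) A))\<^sup>2 * (norm a * norm b)"
proof -
  have c: "\<bar>(A *v y) $ i\<bar> \<le> onorm ((*v) A) * norm y" for y i
    using component_le_norm_cart[of "A *v y" i] onorm[OF matrix_vector_mul_bounded_linear[of A], of y]
    by linarith
  have "\<bar>a \<bullet> (info_mat A x *v b)\<bar> \<le> (\<Sum>i\<in>UNIV. \<bar>x $ i\<bar> * (\<bar>(A *v a) $ i\<bar> * \<bar>(A *v b) $ i\<bar>))"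
    unfolding inner_info_mat by (rule order_trans[OF sum_abs]) (simp add: abs_mult)
  also have "\<dots> \<le> (\<Sum>i\<in>UNIV. \<bar>x $ i\<bar> * ((onorm ((*v) A) * norm a) * (onorm ((*v) A) * norm b)))"
    by (intro sum_mono mult_left_mono mult_mono c) (auto intro!: mult_nonneg_nonneg onorm_pos_le)
  also have "\<dots> = (\<Sum>i\<in>UNIV. \<bar>x $ i\<bar>) * (onorm ((*v) A))\<^sup>2 * (norm a * norm b)"
    by (simp add: sum_distrib_right sum_distrib_left power2_eq_square algebra_simps)
  finally show ?thesis .
qed

lemma det_congruence:
  "det (R ** M ** transpose R) = (det R)\<^sup>2 * det M" for R M :: "real^'n^'n"
  by (simp add: det_mul det_transpose power2_eq_square)

lemma pos_def_det_pos:
  fixes M :: "real^'a^'a"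
  assumes "pos_def M"
  shows "0 < det M"
proof -
  have "transpose M = M" using assms by (simp add: pos_def_def)
  from simultaneous_diagonalization[OF assms this]
  obtain R :: "real^'a^'a" where R: "R ** M ** transpose R = mat 1"
    by metis
  have "(det R)\<^sup>2 * det M = 1"
    by (simp add: R flip: det_congruence)
  then show ?thesis
    using mult_nonneg_nonpos[of "(det R)\<^sup>2" "det M"] by (cases "det M \<le> 0") auto
qed

text \<open>The vectors \<open>c i\<close> form a basis that is orthonormal for the form of \<open>X(x)\<close> and diagonalizes
  that of \<open>X(d)\<close>, with generalized eigenvalues \<open>m i\<close>.\<close>

definition line_diagonalization ::
    "real^'n^'m \<Rightarrow> real^'m \<Rightarrow> real^'m \<Rightarrow> ('n \<Rightarrow> real^'n) \<Rightarrow> ('n \<Rightarrow> real) \<Rightarrow> bool" where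
  "line_diagonalization A x d c m \<longleftrightarrow>
     (\<forall>i. c i \<bullet> (info_mat A x *v c i) = 1) \<and> (\<forall>i. c i \<bullet> (info_mat A d *v c i) = m i) \<and>
     (\<forall>a b. a \<bullet> (info_mat A d *v b)
       = (\<Sum>i\<in>UNIV. m i * ((c i \<bullet> (info_mat A x *v a)) * (c i \<bullet> (info_mat A x *v b))))) \<and>
     (\<forall>r. pos_def (info_mat A (x + r *\<^sub>R d)) \<longleftrightarrow> (\<forall>i. 0 < 1 + r * m i)) \<and>
     (\<forall>r. (\<forall>i. 0 < 1 + r * m i) \<longrightarrow>
       logdet_obj A (x + r *\<^sub>R d) = logdet_obj A x - (\<Sum>i\<in>UNIV. ln (1 + r * m i)))"

lemma line_diagonalizationD:
  assumes "line_diagonalization A x d c m"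
  shows "c i \<bullet> (info_mat A x *v c i) = 1" "c i \<bullet> (info_mat A d *v c i) = m i"
    "a \<bullet> (info_mat A d *v b)
       = (\<Sum>i\<in>UNIV. m i * ((c i \<bullet> (info_mat A x *v a)) * (c i \<bullet> (info_mat A x *v b))))"
    "pos_def (info_mat A (x + r *\<^sub>R d)) \<longleftrightarrow> (\<forall>i. 0 < 1 + r * m i)"
    "(\<And>i. 0 < 1 + r * m i) \<Longrightarrow>
       logdet_obj A (x + r *\<^sub>R d) = logdet_obj A x - (\<Sum>i\<in>UNIV. ln (1 + r * m i))"
  using assms unfolding line_diagonalization_def by blast+

text \<open>In the basis of the rows of \<open>R\<close> the form of X(x + r d) is diagonal with
  entries \<open>1 + r * m $ i\<close>, for all \<open>r\<close> at once. Definiteness and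
  determinant are read off from these entries, so every estimate along a line reduces to a scalar
  one for ln.\<close>

lemma line_diagonalization_exists:
  fixes A :: "real^'n^'m"
  assumes x: "pos_def (info_mat A x)"
  shows "\<exists>c m. line_diagonalization A x d c m"
proof -
  define X where "X = info_mat A x"
  define D where "D = info_mat A d"
  obtain R :: "real^'n^'n" and m where R1: "R ** X ** transpose R = mat 1"
    and R2: "R ** D ** transpose R = diag_mat m"
    and R3: "transpose R ** (R ** X) = mat 1"
    using simultaneous_diagonalization[OF x, of D] by (auto simp: X_def D_def)
  have cX: "R $ i \<bullet> (X *v (R $ j)) = (if i = j then 1 else 0)" for i j
    using R1 unfolding matrix_congruence_nth[symmetric] by (simp add: mat_def)
  have cD: "R $ i \<bullet> (D *v (R $ j)) = (if i = j then m $ i else 0)" for i j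
    using R2 unfolding matrix_congruence_nth[symmetric] by (simp add: diag_mat_def)
  have expand: "b = (\<Sum>i\<in>UNIV. (R $ i \<bullet> (X *v b)) *\<^sub>R R $ i)" for b
  proof -
    have "b = transpose R *v (R *v (X *v b))"
      by (simp add: matrix_vector_mul_assoc R3 matrix_mul_assoc[symmetric])
    also have "\<dots> = (\<Sum>i\<in>UNIV. (R $ i \<bullet> (X *v b)) *\<^sub>R R $ i)"
      by (simp add: vec_eq_iff matrix_vector_mult_def transpose_def inner_vec_def mult.commute)
    finally show ?thesis .
  qed
  \<comment> \<open>A form that is diagonal on the rows is a weighted sum of products of
    coordinates. This serves both X(d) and X(x + r d).\<close>
  have quad: "a \<bullet> (M *v b) = (\<Sum>i\<in>UNIV. e i * ((R $ i \<bullet> (X *v a)) * (R $ i \<bullet> (X *v b))))"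
    if M: "\<And>i j. R $ i \<bullet> (M *v (R $ j)) = (if i = j then e i else 0)" for M e a b
  proof -
    have "M *v (\<Sum>j\<in>UNIV. (R $ j \<bullet> (X *v b)) *\<^sub>R R $ j)
        = (\<Sum>j\<in>UNIV. (R $ j \<bullet> (X *v b)) *\<^sub>R (M *v (R $ j)))"
      by (simp add: linear_sum[OF matrix_vector_mul_linear] matrix_vector_mult_scaleR)
    then have "a \<bullet> (M *v b) = (\<Sum>i\<in>UNIV. (R $ i \<bullet> (X *v a)) *\<^sub>R R $ i) \<bullet>
        (\<Sum>j\<in>UNIV. (R $ j \<bullet> (X *v b)) *\<^sub>R (M *v (R $ j)))"
      by (simp only: expand[symmetric])
    also have "\<dots> = (\<Sum>i\<in>UNIV. \<Sum>j\<in>UNIV. (R $ i \<bullet> (X *v a)) * ((R $ j \<bullet> (X *v b)) * (R $ i \<bullet> (M *v (R $ j)))))"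
      unfolding inner_sum_left unfolding inner_sum_right
      by (intro sum.cong refl) simp
    also have "\<dots> = (\<Sum>i\<in>UNIV. (R $ i \<bullet> (X *v a)) * ((R $ i \<bullet> (X *v b)) * e i))"
      by (simp add: M if_distrib[of "(*) _"] cong: if_cong)
    finally show ?thesis by (simp add: algebra_simps)
  qed
  have cnz: "R $ i \<noteq> 0" for i using cX[of i i] by auto
  have cr: "R $ i \<bullet> (info_mat A (x + r *\<^sub>R d) *v (R $ j)) = (if i = j then 1 + r * m $ i else 0)" for r i j
    using cX[of i j] cD[of i j] by (simp add: inner_info_mat_add X_def D_def)
  have pd: "pos_def (info_mat A (x + r *\<^sub>R d)) \<longleftrightarrow> (\<forall>i. 0 < 1 + r * m $ i)" for r
  proof
    assume "pos_def (info_mat A (x + r *\<^sub>R d))"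
    then have "0 < R $ i \<bullet> (info_mat A (x + r *\<^sub>R d) *v (R $ i))" for i
      unfolding pos_def_def using cnz by blast
    then show "\<forall>i. 0 < 1 + r * m $ i"
      by (simp add: cr)
  next
    assume pos: "\<forall>i. 0 < 1 + r * m $ i"
    show "pos_def (info_mat A (x + r *\<^sub>R d))"
      unfolding pos_def_def
    proof (intro conjI allI impI)
      fix y :: "real^'n" assume "y \<noteq> 0"
      have "\<exists>i. R $ i \<bullet> (X *v y) \<noteq> 0"
      proof (rule ccontr)
        assume "\<not> ?thesis"
        then have "(\<Sum>i\<in>UNIV. (R $ i \<bullet> (X *v y)) *\<^sub>R R $ i) = 0"
          by simp
        then show False
          using \<open>y \<noteq> 0\<close> by (simp only: expand[symmetric])
      qed
      then obtain k where k: "R $ k \<bullet> (X *v y) \<noteq> 0" by blast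
      have "y \<bullet> (info_mat A (x + r *\<^sub>R d) *v y)
          = (\<Sum>i\<in>UNIV. (1 + r * m $ i) * ((R $ i \<bullet> (X *v y)) * (R $ i \<bullet> (X *v y))))"
        by (rule quad[OF cr])
      also have "0 < \<dots>"
      proof (rule sum_pos2[of _ k])
        have "0 < (R $ k \<bullet> (X *v y)) * (R $ k \<bullet> (X *v y))"
          using k by (metis not_square_less_zero linorder_neqE_linordered_idom mult_eq_0_iff)
        then show "0 < (1 + r * m $ k) * ((R $ k \<bullet> (X *v y)) * (R $ k \<bullet> (X *v y)))"
          using pos by simp
        show "0 \<le> (1 + r * m $ i) * ((R $ i \<bullet> (X *v y)) * (R $ i \<bullet> (X *v y)))" for i
          using pos[rule_format, of i] by simp
      qed auto
      finally show "0 < y \<bullet> (info_mat A (x + r *\<^sub>R d) *v y)" .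
    qed simp
  qed
  have det: "det (info_mat A (x + r *\<^sub>R d)) = det X * (\<Prod>i\<in>UNIV. 1 + r * m $ i)" for r
  proof -
    have "det (R ** info_mat A (x + r *\<^sub>R d) ** transpose R)
        = (\<Prod>i\<in>UNIV. (R ** info_mat A (x + r *\<^sub>R d) ** transpose R) $ i $ i)"
      by (rule det_diagonal) (simp add: matrix_congruence_nth cr)
    then have 1: "(det R)\<^sup>2 * det (info_mat A (x + r *\<^sub>R d)) = (\<Prod>i\<in>UNIV. 1 + r * m $ i)"
      by (simp add: det_congruence matrix_congruence_nth cr)
    have "det (R ** X ** transpose R) = 1" by (simp add: R1 det_I)
    then have 2: "(det R)\<^sup>2 * det X = 1" by (simp add: det_congruence)
    \<comment> \<open>The squared determinant of \<open>R\<close> is the reciprocal of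
      \<open>det X\<close>, so it cancels.\<close>
    have "det (info_mat A (x + r *\<^sub>R d)) = ((det R)\<^sup>2 * det X) * det (info_mat A (x + r *\<^sub>R d))"
      by (simp only: 2 mult_1_left)
    also have "\<dots> = det X * ((det R)\<^sup>2 * det (info_mat A (x + r *\<^sub>R d)))"
      by (simp only: mult_ac)
    finally show ?thesis by (simp only: 1)
  qed
  have obj: "logdet_obj A (x + r *\<^sub>R d) = logdet_obj A x - (\<Sum>i\<in>UNIV. ln (1 + r * m $ i))"
    if pos: "\<forall>i. 0 < 1 + r * m $ i" for r
  proof -
    have "ln (det X * (\<Prod>i\<in>UNIV. 1 + r * m $ i)) = ln (det X) + ln (\<Prod>i\<in>UNIV. 1 + r * m $ i)"
      using pos_def_det_pos[OF x] pos by (intro ln_mult_pos) (auto simp: X_def intro!: prod_pos)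
    also have "ln (\<Prod>i\<in>UNIV. 1 + r * m $ i) = (\<Sum>i\<in>UNIV. ln (1 + r * m $ i))"
      using pos by (intro ln_prod) (auto simp: less_imp_neq[symmetric])
    finally show ?thesis by (simp add: logdet_obj_def det X_def)
  qed
  have "a \<bullet> (info_mat A d *v b) = (\<Sum>i\<in>UNIV. m $ i *
        ((R $ i \<bullet> (info_mat A x *v a)) * (R $ i \<bullet> (info_mat A x *v b))))" for a b
    using quad[OF cD] by (simp add: X_def D_def)
  then have "line_diagonalization A x d (($) R) (($) m)"
    unfolding line_diagonalization_def using cX cD pd obj by (simp add: X_def D_def)
  then show ?thesis by blast
qed

text \<open>The sum of the \<open>m i\<close> is the trace of X(d) relative to X(x). The explicit
  formula for the objective along the line is differentiated at 0; it is valid near 0, where the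
  finitely many factors \<open>1 + r * m i\<close> are positive.\<close>

lemma gradient_along_line:
  fixes A :: "real^'n^'m" and m :: "'n \<Rightarrow> real"
  assumes g: "GDERIV (logdet_obj A) x :> g"
    and ld: "line_diagonalization A x d c m"
  shows "g \<bullet> d = - (\<Sum>i\<in>UNIV. m i)"
proof -
  have 1: "((\<lambda>r. logdet_obj A (x + r *\<^sub>R d)) has_field_derivative g \<bullet> d) (at 0)"
  proof -
    have "((\<lambda>r. x + r *\<^sub>R d) has_derivative (\<lambda>r. r *\<^sub>R d)) (at 0)"
      by (auto intro!: derivative_eq_intros)
    from has_derivative_compose[OF this, of "logdet_obj A" "\<lambda>h. h \<bullet> g"] g
    have "((\<lambda>r. logdet_obj A (x + r *\<^sub>R d)) has_derivative (\<lambda>r. (r *\<^sub>R d) \<bullet> g)) (at 0)"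
      by (simp add: gderiv_def)
    then show ?thesis
      unfolding has_field_derivative_def
      by (rule has_derivative_eq_rhs) (simp add: fun_eq_iff inner_commute)
  qed
  have 2: "((\<lambda>r. logdet_obj A x - (\<Sum>i\<in>UNIV. ln (1 + r * m i))) has_field_derivative
      - (\<Sum>i\<in>UNIV. m i)) (at 0)"
    by (auto intro!: derivative_eq_intros)
  have ev: "\<forall>\<^sub>F r in nhds 0. \<forall>i. 0 < 1 + r * m i"
  proof (rule eventually_all_finite)
    fix i
    have "((\<lambda>r. 1 + r * m i) \<longlongrightarrow> 1 + 0 * m i) (nhds 0)"
      by (intro tendsto_intros filterlim_ident)
    then show "\<forall>\<^sub>F r in nhds 0. 0 < 1 + r * m i"
      by (rule order_tendstoD) simp
  qed
  have "((\<lambda>r. logdet_obj A (x + r *\<^sub>R d)) has_field_derivative - (\<Sum>i\<in>UNIV. m i)) (at 0)"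
    by (subst DERIV_cong_ev[OF refl _ refl, of _ "\<lambda>r. logdet_obj A x - (\<Sum>i\<in>UNIV. ln (1 + r * m i))"])
       (use ev line_diagonalizationD(5)[OF ld] 2 in \<open>auto elim: eventually_mono\<close>)
  with 1 show ?thesis using DERIV_unique by blast
qed

section \<open>Quadratic estimates for the objective\<close>

lemma ln_one_plus_le_quadratic:
  fixes t M :: real
  assumes "-1 < t" "t \<le> M"
  shows "ln (1 + t) \<le> t - t\<^sup>2 / (2 * (2 + M))"
proof -
  \<comment> \<open>Using \<open>ln s \<le> s - 1\<close> at the square root of \<open>1 + t\<close>
    leaves \<open>(s - 1)\<^sup>2\<close> as a gain, and \<open>t\<^sup>2\<close> is at most
    \<open>2 * (2 + M)\<close> times this square.\<close>
  define s where "s = sqrt (1 + t)"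
  have s: "s > 0" "s\<^sup>2 = 1 + t" using assms by (auto simp: s_def)
  have "ln (1 + t) = 2 * ln s" using s by (simp flip: s(2) add: ln_realpow)
  also have "\<dots> \<le> 2 * (s - 1)" using ln_le_minus_one[OF s(1)] by simp
  also have "\<dots> = t - (s - 1)\<^sup>2" using s(2) by (simp add: power2_eq_square algebra_simps)
  also have "\<dots> \<le> t - t\<^sup>2 / (2 * (2 + M))"
  proof -
    have "t\<^sup>2 = (s - 1)\<^sup>2 * (s + 1)\<^sup>2"
    proof -
      have "t = (s - 1) * (s + 1)" using s(2) by (simp add: power2_eq_square algebra_simps)
      then show ?thesis by (simp add: power_mult_distrib)
    qed
    also have "(s + 1)\<^sup>2 \<le> 2 * (2 + M)"
    proof -
      have "(s + 1)\<^sup>2 + (s - 1)\<^sup>2 = 2 * (2 + t)" using s(2) by (simp add: power2_eq_square algebra_simps)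
      then have "(s + 1)\<^sup>2 \<le> 2 * (2 + t)" by (metis add_increasing2 order_refl zero_le_power2)
      also have "\<dots> \<le> 2 * (2 + M)" using assms by simp
      finally show ?thesis .
    qed
    finally have "t\<^sup>2 \<le> (s - 1)\<^sup>2 * (2 * (2 + M))" by (simp add: mult_left_mono)
    then show ?thesis using assms by (simp add: field_simps)
  qed
  finally show ?thesis .
qed

lemma ln_one_plus_ge_quadratic:
  fixes t :: real
  assumes "\<bar>t\<bar> \<le> 1 / 2"
  shows "t - 2 * t\<^sup>2 \<le> ln (1 + t)"
  using abs_ln_one_plus_x_minus_x_bound[OF assms] by linarith

lemma norm_matrix_le_entries:
  fixes D :: "real^'n^'n"
  assumes "\<And>j k. \<bar>D $ j $ k\<bar> \<le> b"
  shows "norm D \<le> (real CARD('n))\<^sup>2 * b"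
proof -
  have "norm (D $ j) \<le> real CARD('n) * b" for j
  proof -
    have "norm (D $ j) \<le> (\<Sum>k\<in>UNIV. \<bar>D $ j $ k\<bar>)" by (rule norm_le_l1_cart)
    also have "\<dots> \<le> (\<Sum>k\<in>(UNIV::'n set). b)" using assms by (intro sum_mono) auto
    finally show ?thesis by simp
  qed
  then have "(\<Sum>j\<in>UNIV. norm (D $ j)) \<le> (\<Sum>j\<in>(UNIV::'n set). real CARD('n) * b)"
    by (intro sum_mono)
  moreover have "norm D \<le> (\<Sum>j\<in>UNIV. norm (D $ j))"
    unfolding norm_vec_def by (rule L2_set_le_sum) auto
  ultimately show ?thesis by (simp add: power2_eq_square)
qed

lemma sum_abs_squared_le:
  fixes m :: "'n::finite \<Rightarrow> real"
  shows "(\<Sum>i\<in>UNIV. \<bar>m i\<bar>)\<^sup>2 \<le> real CARD('n) * (\<Sum>i\<in>UNIV. (m i)\<^sup>2)"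
  using Cauchy_Schwarz_ineq_sum[of "\<lambda>_. 1" "\<lambda>i. \<bar>m i\<bar>" UNIV] by simp

text \<open>After diagonalization the gap above the tangent is the sum of
  \<open>m i - ln (1 + m i)\<close>. Each term is at least a fixed multiple of
  \<open>(m i)\<^sup>2\<close> once the \<open>m i\<close> are bounded above; on the other side
  \<open>-1 < m i\<close> suffices, so \<open>y\<close> may be arbitrarily close to singular and
  only \<open>x\<close> carries the bound \<open>\<alpha>\<close>. The rest compares the sum of
  squares with the norm of X(y - x).\<close>

lemma logdet_strongly_convex:
  fixes A :: "real^'n^'m"
  assumes \<alpha>: "0 < \<alpha>" and B: "0 \<le> B"
  shows "\<exists>\<kappa>>0. \<forall>x y g. GDERIV (logdet_obj A) x :> g \<longrightarrow> pos_def (info_mat A x) \<longrightarrow>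
    pos_def (info_mat A y) \<longrightarrow> (\<forall>z. \<alpha> * (norm z)\<^sup>2 \<le> z \<bullet> (info_mat A x *v z)) \<longrightarrow>
    (\<Sum>i\<in>UNIV. \<bar>x $ i\<bar>) \<le> B \<longrightarrow> (\<Sum>i\<in>UNIV. \<bar>y $ i\<bar>) \<le> B \<longrightarrow>
    logdet_obj A x + g \<bullet> (y - x) + \<kappa> * (norm (info_mat A (y - x)))\<^sup>2 \<le> logdet_obj A y"
proof -
  \<comment> \<open>\<open>\<Lambda>\<close> bounds the form of X(v) on unit vectors when the
    entries of \<open>v\<close> have total size at most \<open>B\<close>. As the \<open>c i\<close>
    have squared norm at most \<open>1 / \<alpha>\<close>, \<open>M\<close> bounds the
    \<open>m i\<close> from above, and \<open>q\<close> bounds the norm of X(y - x) by the sum of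
    the \<open>\<bar>m i\<bar>\<close>.\<close>
  define \<Lambda> where "\<Lambda> = B * (onorm ((*v) A))\<^sup>2"
  have \<Lambda>: "0 \<le> \<Lambda>" using B by (simp add: \<Lambda>_def)
  define M where "M = \<Lambda> / \<alpha>"
  have M: "0 \<le> M" using \<Lambda> \<alpha> by (simp add: M_def)
  define q where "q = (real CARD('n))\<^sup>2 * (\<Lambda>\<^sup>2 / \<alpha>)"
  \<comment> \<open>The summand 1 keeps \<open>K\<close> positive when \<open>q\<close> vanishes, as
    for \<open>B = 0\<close>.\<close>
  define K where "K = 1 + q\<^sup>2 * real CARD('n)"
  have K: "0 < K" unfolding K_def by (intro add_pos_nonneg) auto
  show ?thesis
  proof (intro exI[of _ "1 / (2 * (2 + M) * K)"] conjI allI impI)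
    show "0 < 1 / (2 * (2 + M) * K)" using M K by simp
    fix x y g
    assume g: "GDERIV (logdet_obj A) x :> g" and x: "pos_def (info_mat A x)" and y: "pos_def (info_mat A y)"
      and lam: "\<forall>z. \<alpha> * (norm z)\<^sup>2 \<le> z \<bullet> (info_mat A x *v z)"
      and xB: "(\<Sum>i\<in>UNIV. \<bar>x $ i\<bar>) \<le> B" and yB: "(\<Sum>i\<in>UNIV. \<bar>y $ i\<bar>) \<le> B"
    have bound: "\<bar>a \<bullet> (info_mat A v *v b)\<bar> \<le> \<Lambda> * (norm a * norm b)" if "(\<Sum>i\<in>UNIV. \<bar>v $ i\<bar>) \<le> B" for v a b
      using abs_inner_info_mat_le[of a A v b] that unfolding \<Lambda>_def
      by (meson mult_right_mono order_trans zero_le_power2 mult_nonneg_nonneg norm_ge_zero)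
    obtain c m where ld: "line_diagonalization A x (y - x) c m"
      using line_diagonalization_exists[OF x] by blast
    note 1 = line_diagonalizationD(1)[OF ld] and 2 = line_diagonalizationD(2)[OF ld]
      and 3 = line_diagonalizationD(3)[OF ld] and 4 = line_diagonalizationD(4)[OF ld]
      and 5 = line_diagonalizationD(5)[OF ld]
    have gd: "g \<bullet> (y - x) = - (\<Sum>i\<in>UNIV. m i)"
      using gradient_along_line[OF g ld] .
    have m1: "0 < 1 + m i" for i using 4[of 1] y by simp
    have c2: "(norm (c i))\<^sup>2 \<le> 1 / \<alpha>" for i
      using lam[rule_format, of "c i"] 1[of i] \<alpha> by (simp add: field_simps)
    have mM: "m i \<le> M" for i
    proof -
      have "1 + m i = c i \<bullet> (info_mat A y *v c i)"
        using inner_info_mat_add[of "c i" A x 1 "y - x" "c i"] by (simp add: 1 2)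
      also have "\<dots> \<le> \<Lambda> * (norm (c i))\<^sup>2"
        using bound[OF yB, of "c i" "c i"] by (simp add: power2_eq_square)
      also have "\<dots> \<le> M" using mult_left_mono[OF c2[of i] \<Lambda>] by (simp add: M_def)
      finally show ?thesis by simp
    qed
    have fy: "logdet_obj A y = logdet_obj A x - (\<Sum>i\<in>UNIV. ln (1 + m i))"
      using 5[of 1] m1 by simp
    have "(\<Sum>i\<in>UNIV. ln (1 + m i)) \<le> (\<Sum>i\<in>UNIV. m i - (m i)\<^sup>2 / (2 * (2 + M)))"
      using m1 mM by (intro sum_mono ln_one_plus_le_quadratic) (auto simp: less_diff_eq, smt (verit))
    then have A: "logdet_obj A x + g \<bullet> (y - x) + (\<Sum>i\<in>UNIV. (m i)\<^sup>2) / (2 * (2 + M)) \<le> logdet_obj A y"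
      by (simp add: fy gd sum_subtractf sum_divide_distrib)
    have ent: "\<bar>info_mat A (y - x) $ j $ k\<bar> \<le> \<Lambda>\<^sup>2 / \<alpha> * (\<Sum>i\<in>UNIV. \<bar>m i\<bar>)" for j k
    proof -
      have "info_mat A (y - x) $ j $ k = axis j 1 \<bullet> (info_mat A (y - x) *v axis k 1)"
        by (simp add: inner_axis' matrix_vector_mult_basis column_def)
      then have "\<bar>info_mat A (y - x) $ j $ k\<bar> \<le> (\<Sum>i\<in>UNIV. \<bar>m i * ((c i \<bullet> (info_mat A x *v axis j 1)) * (c i \<bullet> (info_mat A x *v axis k 1)))\<bar>)"
        by (simp only: 3 sum_abs)
      also have "\<dots> \<le> (\<Sum>i\<in>UNIV. \<bar>m i\<bar> * (\<Lambda>\<^sup>2 / \<alpha>))"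
      proof (intro sum_mono)
        fix i
        have "\<bar>c i \<bullet> (info_mat A x *v axis l 1)\<bar> \<le> \<Lambda> * norm (c i)" for l
          using bound[OF xB, of "c i" "axis l 1"] by simp
        then have "\<bar>c i \<bullet> (info_mat A x *v axis j 1)\<bar> * \<bar>c i \<bullet> (info_mat A x *v axis k 1)\<bar>
           \<le> (\<Lambda> * norm (c i)) * (\<Lambda> * norm (c i))"
          by (intro mult_mono) (auto simp: \<Lambda>)
        also have "\<dots> = \<Lambda>\<^sup>2 * (norm (c i))\<^sup>2" by (simp add: power2_eq_square)
        also have "\<dots> \<le> \<Lambda>\<^sup>2 / \<alpha>" using mult_left_mono[OF c2[of i], of "\<Lambda>\<^sup>2"] by simp
        finally show "\<bar>m i * ((c i \<bullet> (info_mat A x *v axis j 1)) * (c i \<bullet> (info_mat A x *v axis k 1)))\<bar> \<le> \<bar>m i\<bar> * (\<Lambda>\<^sup>2 / \<alpha>)"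
          unfolding abs_mult by (intro mult_left_mono) auto
      qed
      also have "\<dots> = \<Lambda>\<^sup>2 / \<alpha> * (\<Sum>i\<in>UNIV. \<bar>m i\<bar>)" by (metis sum_distrib_right mult.commute)
      finally show ?thesis .
    qed
    have "norm (info_mat A (y - x)) \<le> q * (\<Sum>i\<in>UNIV. \<bar>m i\<bar>)"
      using norm_matrix_le_entries[OF ent] by (simp add: q_def mult.assoc)
    then have "(norm (info_mat A (y - x)))\<^sup>2 \<le> (q * (\<Sum>i\<in>UNIV. \<bar>m i\<bar>))\<^sup>2" by (rule power_mono) simp
    also have "\<dots> \<le> q\<^sup>2 * (real CARD('n) * (\<Sum>i\<in>UNIV. (m i)\<^sup>2))"
      unfolding power_mult_distrib by (intro mult_left_mono sum_abs_squared_le) simp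
    also have "\<dots> \<le> K * (\<Sum>i\<in>UNIV. (m i)\<^sup>2)"
      unfolding K_def by (simp add: distrib_right sum_nonneg)
    finally have "(norm (info_mat A (y - x)))\<^sup>2 / K \<le> (\<Sum>i\<in>UNIV. (m i)\<^sup>2)"
      using K by (simp add: field_simps)
    then have "(norm (info_mat A (y - x)))\<^sup>2 / K / (2 * (2 + M)) \<le> (\<Sum>i\<in>UNIV. (m i)\<^sup>2) / (2 * (2 + M))"
      using M by (intro divide_right_mono) auto
    moreover have "1 / (2 * (2 + M) * K) * (norm (info_mat A (y - x)))\<^sup>2 = (norm (info_mat A (y - x)))\<^sup>2 / K / (2 * (2 + M))"
      by (simp add: mult.commute)
    ultimately show "logdet_obj A x + g \<bullet> (y - x) + 1 / (2 * (2 + M) * K) * (norm (info_mat A (y - x)))\<^sup>2 \<le> logdet_obj A y"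
      using A by linarith
  qed
qed

text \<open>The objective is infinite outside its domain, so a quadratic upper bound can hold only
  for short steps. The limit on \<open>r\<close> is the minimizer of that bound, and it is short
  enough by itself: \<open>g \<bullet> d\<close> is at most \<open>n * M\<close>, so with
  \<open>2 * n * M\<^sup>2\<close> for \<open>L\<close> it follows that
  \<open>r * M \<le> 1 / 4\<close>, and all \<open>1 - r * m i\<close> stay away from 0.\<close>

lemma logdet_descent:
  fixes A :: "real^'n^'m"
  assumes \<alpha>: "0 < \<alpha>" and B: "0 \<le> B"
  shows "\<exists>L>0. \<forall>x d g r. GDERIV (logdet_obj A) x :> g \<longrightarrow> pos_def (info_mat A x) \<longrightarrow>
    (\<forall>z. \<alpha> * (norm z)\<^sup>2 \<le> z \<bullet> (info_mat A x *v z)) \<longrightarrow>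
    (\<Sum>i\<in>UNIV. \<bar>d $ i\<bar>) \<le> B \<longrightarrow> 0 \<le> r \<longrightarrow> r \<le> (g \<bullet> d) / (2 * L) \<longrightarrow>
    pos_def (info_mat A (x - r *\<^sub>R d)) \<and>
    logdet_obj A (x - r *\<^sub>R d) \<le> logdet_obj A x - r * (g \<bullet> d) + L * r\<^sup>2"
proof -
  define n where "n = real CARD('n)"
  have n: "n > 0" by (simp add: n_def)
  define M where "M = B * (onorm ((*v) A))\<^sup>2 / \<alpha> + 1"
  have M: "0 < M" using B \<alpha> by (simp add: M_def add_nonneg_pos)
  show ?thesis
  proof (intro exI[of _ "2 * n * M\<^sup>2"] allI impI conjI)
    show "0 < 2 * n * M\<^sup>2" using n M by simp
    fix x d g and r :: real
    assume g: "GDERIV (logdet_obj A) x :> g" and x: "pos_def (info_mat A x)"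
      and lam: "\<forall>z. \<alpha> * (norm z)\<^sup>2 \<le> z \<bullet> (info_mat A x *v z)"
      and dB: "(\<Sum>i\<in>UNIV. \<bar>d $ i\<bar>) \<le> B" and r0: "0 \<le> r" and r: "r \<le> (g \<bullet> d) / (2 * (2 * n * M\<^sup>2))"
    obtain c m where ld: "line_diagonalization A x d c m"
      using line_diagonalization_exists[OF x] by blast
    note 1 = line_diagonalizationD(1)[OF ld] and 2 = line_diagonalizationD(2)[OF ld]
      and 4 = line_diagonalizationD(4)[OF ld] and 5 = line_diagonalizationD(5)[OF ld]
    have gd: "g \<bullet> d = - (\<Sum>i\<in>UNIV. m i)"
      using gradient_along_line[OF g ld] .
    have c2: "(norm (c i))\<^sup>2 \<le> 1 / \<alpha>" for i
      using lam[rule_format, of "c i"] 1[of i] \<alpha> by (simp add: field_simps)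
    have mM: "\<bar>m i\<bar> \<le> M" for i
    proof -
      have "\<bar>m i\<bar> \<le> (\<Sum>i\<in>UNIV. \<bar>d $ i\<bar>) * (onorm ((*v) A))\<^sup>2 * (norm (c i) * norm (c i))"
        using abs_inner_info_mat_le[of "c i" A d "c i"] by (simp add: 2)
      also have "\<dots> \<le> B * (onorm ((*v) A))\<^sup>2 * (norm (c i) * norm (c i))"
        using dB by (intro mult_right_mono) auto
      also have "\<dots> \<le> B * (onorm ((*v) A))\<^sup>2 * (1 / \<alpha>)"
        using c2[of i] B by (intro mult_left_mono) (auto simp: power2_eq_square)
      finally show ?thesis by (simp add: M_def)
    qed
    have "g \<bullet> d \<le> (\<Sum>i\<in>(UNIV::'n set). M)"
      unfolding gd sum_negf[symmetric] using mM by (intro sum_mono) (smt (verit))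
    then have "g \<bullet> d \<le> n * M" by (simp add: n_def)
    then have "r \<le> n * M / (2 * (2 * n * M\<^sup>2))"
      using r n M by (meson divide_right_mono order_trans mult_nonneg_nonneg less_imp_le zero_le_numeral zero_le_power2)
    also have "\<dots> = 1 / (4 * M)" using n M by (simp add: power2_eq_square field_simps)
    finally have r': "r * M \<le> 1 / 4" using M by (simp add: field_simps)
    have rm: "\<bar>- r * m i\<bar> \<le> 1 / 4" for i
      using mult_left_mono[OF mM[of i] r0] r' r0 by (simp add: abs_mult)
    then have pos: "\<forall>i. 0 < 1 + (- r) * m i"
      by (smt (verit) divide_less_eq_1_pos)
    show "pos_def (info_mat A (x - r *\<^sub>R d))"
      using 4[of "- r"] pos by simp
    have "(\<Sum>i\<in>UNIV. (- r) * m i - 2 * (r\<^sup>2 * M\<^sup>2)) \<le> (\<Sum>i\<in>UNIV. ln (1 + (- r) * m i))"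
    proof (intro sum_mono)
      fix i
      have "((- r) * m i)\<^sup>2 \<le> r\<^sup>2 * M\<^sup>2"
        using abs_le_square_iff[of "m i" M] mM[of i] M
        by (simp add: power_mult_distrib mult_left_mono)
      moreover have "(- r) * m i - 2 * ((- r) * m i)\<^sup>2 \<le> ln (1 + (- r) * m i)"
        using rm[of i] by (intro ln_one_plus_ge_quadratic) linarith
      ultimately show "(- r) * m i - 2 * (r\<^sup>2 * M\<^sup>2) \<le> ln (1 + (- r) * m i)"
        by linarith
    qed
    moreover have "(\<Sum>i\<in>UNIV. (- r) * m i - 2 * (r\<^sup>2 * M\<^sup>2)) = r * (g \<bullet> d) - 2 * n * M\<^sup>2 * r\<^sup>2"
      by (simp add: sum_subtractf gd n_def sum_distrib_left[symmetric] sum_negf)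
    ultimately show "logdet_obj A (x - r *\<^sub>R d) \<le> logdet_obj A x - r * (g \<bullet> d) + 2 * n * M\<^sup>2 * r\<^sup>2"
      using 5[OF pos[rule_format]] by simp
  qed
qed

lemma pos_def_info_mat_convex:
  fixes A :: "real^'n^'m"
  assumes x: "pos_def (info_mat A x)" and y: "pos_def (info_mat A y)" and t: "0 \<le> t" "t \<le> 1"
  shows "pos_def (info_mat A ((1 - t) *\<^sub>R x + t *\<^sub>R y))"
  unfolding pos_def_def
proof (intro conjI allI impI)
  fix z :: "real^'n" assume z: "z \<noteq> 0"
  have "z \<bullet> (info_mat A ((1 - t) *\<^sub>R x + t *\<^sub>R y) *v z)
      = (1 - t) * (z \<bullet> (info_mat A x *v z)) + t * (z \<bullet> (info_mat A y *v z))"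
    by (simp add: inner_info_mat sum_distrib_left algebra_simps flip: sum.distrib)
  also have "\<dots> > 0"
    using x y t z by (cases "t = 0") (auto simp: pos_def_def intro!: add_nonneg_pos)
  finally show "0 < z \<bullet> (info_mat A ((1 - t) *\<^sub>R x + t *\<^sub>R y) *v z)" .
qed simp

text \<open>This is concavity of ln between 1 and \<open>1 + m i\<close>, summed over
  \<open>i\<close>. It is what makes an interior line search minimizer optimal on the whole
  ray.\<close>

lemma logdet_convex:
  fixes A :: "real^'n^'m"
  assumes x: "pos_def (info_mat A x)" and y: "pos_def (info_mat A y)" and t: "0 \<le> t" "t \<le> 1"
  shows "logdet_obj A ((1 - t) *\<^sub>R x + t *\<^sub>R y) \<le> (1 - t) * logdet_obj A x + t * logdet_obj A y"
proof -
  obtain c m where ld: "line_diagonalization A x (y - x) c m"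
    using line_diagonalization_exists[OF x] by blast
  note 4 = line_diagonalizationD(4)[OF ld] and 5 = line_diagonalizationD(5)[OF ld]
  have m1: "0 < 1 + m i" for i using 4[of 1] y by simp
  have eq: "1 + t * m i = (1 - t) * 1 + t * (1 + m i)" for i by (simp add: algebra_simps)
  have mt: "0 < 1 + t * m i" for i
    unfolding eq using t m1[of i] by (cases "t = 0") (auto intro: add_nonneg_pos)
  have "t * ln (1 + m i) \<le> ln (1 + t * m i)" for i
    unfolding eq using concave_onD[OF ln_concave t, of 1 "1 + m i"] m1[of i] by simp
  then have "(\<Sum>i\<in>UNIV. t * ln (1 + m i)) \<le> (\<Sum>i\<in>UNIV. ln (1 + t * m i))"
    by (intro sum_mono)
  then have "logdet_obj A (x + t *\<^sub>R (y - x)) \<le> logdet_obj A x - t * (\<Sum>i\<in>UNIV. ln (1 + m i))"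
    using 5[of t] mt by (simp add: sum_distrib_left)
  moreover have "logdet_obj A y = logdet_obj A x - (\<Sum>i\<in>UNIV. ln (1 + m i))"
    using 5[of 1] m1 by simp
  moreover have "(1 - t) *\<^sub>R x + t *\<^sub>R y = x + t *\<^sub>R (y - x)"
    by (simp add: algebra_simps)
  ultimately have "logdet_obj A ((1 - t) *\<^sub>R x + t *\<^sub>R y) \<le> logdet_obj A x - t * (\<Sum>i\<in>UNIV. ln (1 + m i))"
    "logdet_obj A x - t * (\<Sum>i\<in>UNIV. ln (1 + m i)) = (1 - t) * logdet_obj A x + t * logdet_obj A y"
    by (simp_all add: right_diff_distrib left_diff_distrib)
  then show ?thesis by simp
qed

section \<open>The strong Frank-Wolfe gap\<close>

text \<open>A Hoffman bound for the cone generated by \<open>B\<close>. Positive relations among the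
  generators, or a kernel of \<open>E\<close>, allow large coefficients for a small image; therefore
  the bound concerns other coefficients \<open>\<beta>'\<close> with the same image.\<close>

definition conic_coefficient_bound :: "('a::real_vector \<Rightarrow> 'b::real_normed_vector) \<Rightarrow> 'a set \<Rightarrow> real \<Rightarrow> bool" where
  "conic_coefficient_bound E B C \<longleftrightarrow> (\<forall>\<beta>. (\<forall>b\<in>B. 0 \<le> \<beta> b) \<longrightarrow>
    (\<exists>\<beta>'. (\<forall>b\<in>B. 0 \<le> \<beta>' b) \<and> E (\<Sum>b\<in>B. \<beta>' b *\<^sub>R b) = E (\<Sum>b\<in>B. \<beta> b *\<^sub>R b) \<and>
      (\<Sum>b\<in>B. \<beta>' b) \<le> C * norm (E (\<Sum>b\<in>B. \<beta> b *\<^sub>R b))))"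

text \<open>If 0 is not in the image of the convex hull, its distance to this compact set bounds the
  total weight of every conic combination, by normalization. Otherwise Caratheodory's elimination
  leads to a smaller set of generators.\<close>

lemma conic_coefficient_bound_exists:
  fixes E :: "'a::real_vector \<Rightarrow> 'b::euclidean_space"
  assumes E: "linear E" and B: "finite B"
  shows "\<exists>C>0. conic_coefficient_bound E B C"
  using B
proof (induction B rule: finite_psubset_induct)
  case (psubset B)
  show ?case
  proof (cases "0 \<in> E ` (convex hull B)")
    case False
    have "compact (convex hull (E ` B))"
      using psubset.hyps by (intro finite_imp_compact_convex_hull) auto
    then have "closed (E ` (convex hull B))"
      using convex_hull_linear_image[OF E, of B] by (simp add: compact_imp_closed)
    then obtain m where m: "m > 0" "\<And>q. q \<in> E ` (convex hull B) \<Longrightarrow> m \<le> norm q"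
      using separate_point_closed[OF _ False] by (auto simp: dist_norm)
    have "(\<Sum>b\<in>B. \<beta> b) \<le> 1 / m * norm (E (\<Sum>b\<in>B. \<beta> b *\<^sub>R b))" if \<beta>: "\<forall>b\<in>B. 0 \<le> \<beta> b" for \<beta>
    proof (cases "(\<Sum>b\<in>B. \<beta> b) = 0")
      case True
      then show ?thesis using m by simp
    next
      case nz: False
      define s where "s = (\<Sum>b\<in>B. \<beta> b)"
      have s: "s > 0" using nz \<beta> by (simp add: s_def sum_nonneg order_less_le)
      have "(\<Sum>b\<in>B. (\<beta> b / s) *\<^sub>R b) \<in> convex hull B"
        unfolding convex_hull_finite[OF psubset.hyps(1)] mem_Collect_eq
        using \<beta> s by (intro exI[of _ "\<lambda>b. \<beta> b / s"]) (auto simp: s_def sum_divide_distrib[symmetric])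
      then have "m \<le> norm (E (\<Sum>b\<in>B. (\<beta> b / s) *\<^sub>R b))" using m(2) by blast
      moreover have "(\<Sum>b\<in>B. (\<beta> b / s) *\<^sub>R b) = (1 / s) *\<^sub>R (\<Sum>b\<in>B. \<beta> b *\<^sub>R b)"
        by (simp add: scaleR_sum_right)
      ultimately have "m \<le> norm (E (\<Sum>b\<in>B. \<beta> b *\<^sub>R b)) / s"
        using s by (simp add: linear_scale[OF E])
      then show ?thesis using s m unfolding s_def[symmetric] by (simp add: field_simps)
    qed
    then have "conic_coefficient_bound E B (1 / m)"
      unfolding conic_coefficient_bound_def by blast
    then show ?thesis
      using m(1) by (intro exI[of _ "1 / m"]) auto
  next
    \<comment> \<open>A nonnegative relation among the generators lets one coefficient be cancelled.\<close>
    case True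
    then obtain u where "\<forall>b\<in>B. 0 \<le> u b" "(\<Sum>b\<in>B. u b) = 1" "E (\<Sum>b\<in>B. u b *\<^sub>R b) = 0"
      unfolding convex_hull_finite[OF psubset.hyps(1)] by fastforce
    then have u: "\<And>b. b \<in> B \<Longrightarrow> 0 \<le> u b" "(\<Sum>b\<in>B. u b) = 1" "E (\<Sum>b\<in>B. u b *\<^sub>R b) = 0"
      by auto
    have "\<exists>C>0. conic_coefficient_bound E (B - {i}) C" if "i \<in> B" for i
      using that by (intro psubset.IH) auto
    then obtain C where C: "\<And>i. i \<in> B \<Longrightarrow> C i > 0"
      and CI: "\<And>i. i \<in> B \<Longrightarrow> conic_coefficient_bound E (B - {i}) (C i)"
      by metis
    \<comment> \<open>Which generator is eliminated depends on \<open>\<beta>\<close>; a constant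
      above every \<open>C i\<close> serves all cases.\<close>
    have le: "C i \<le> 1 + sum C B" if "i \<in> B" for i
    proof -
      have "C i \<le> sum C B"
        using that psubset.hyps(1) by (intro member_le_sum) (auto intro: less_imp_le[OF C])
      then show ?thesis by simp
    qed
    have "\<exists>\<beta>'. (\<forall>b\<in>B. 0 \<le> \<beta>' b) \<and> E (\<Sum>b\<in>B. \<beta>' b *\<^sub>R b) = E (\<Sum>b\<in>B. \<beta> b *\<^sub>R b) \<and>
      (\<Sum>b\<in>B. \<beta>' b) \<le> (1 + sum C B) * norm (E (\<Sum>b\<in>B. \<beta> b *\<^sub>R b))"
      if \<beta>: "\<forall>b\<in>B. 0 \<le> \<beta> b" for \<beta>
    proof -
      define T where "T = {b \<in> B. u b > 0}"
      have T: "finite T" using psubset.hyps(1) by (simp add: T_def)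
      have "T \<noteq> {}"
      proof
        assume "T = {}"
        then have "u b = 0" if "b \<in> B" for b using u(1)[OF that] that by (force simp: T_def)
        then show False using u(2) by simp
      qed
      \<comment> \<open>Ratio test: \<open>t\<close> is the largest multiple of the relation
        \<open>u\<close> that can be subtracted while all coefficients stay nonnegative; at a
        minimizing index the coefficient becomes 0.\<close>
      define t where "t = Min ((\<lambda>b. \<beta> b / u b) ` T)"
      have "t \<in> (\<lambda>b. \<beta> b / u b) ` T"
        unfolding t_def using T \<open>T \<noteq> {}\<close> by (intro Min_in) auto
      then obtain i where i: "i \<in> T" "t = \<beta> i / u i" by blast
      have iB: "i \<in> B" and ui: "u i > 0" using i by (auto simp: T_def)
      have tle: "t \<le> \<beta> b / u b" if "b \<in> T" for b
        unfolding t_def using T that by (intro Min_le) auto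
      have t0: "t \<ge> 0" using i \<beta> ui iB by simp
      define \<beta>1 where "\<beta>1 b = \<beta> b - t * u b" for b
      have "0 \<le> \<beta>1 b" if "b \<in> B" for b
      proof (cases "b \<in> T")
        case True
        then show ?thesis using tle[OF True] by (simp add: \<beta>1_def T_def field_simps)
      next
        case False
        then have "u b = 0" using u(1)[OF that] that by (force simp: T_def)
        then show ?thesis using \<beta> that by (simp add: \<beta>1_def)
      qed
      then have "\<forall>b\<in>B - {i}. 0 \<le> \<beta>1 b" by blast
      then obtain \<beta>' where \<beta>': "\<forall>b\<in>B - {i}. 0 \<le> \<beta>' b"
        "E (\<Sum>b\<in>B - {i}. \<beta>' b *\<^sub>R b) = E (\<Sum>b\<in>B - {i}. \<beta>1 b *\<^sub>R b)"
        "(\<Sum>b\<in>B - {i}. \<beta>' b) \<le> C i * norm (E (\<Sum>b\<in>B - {i}. \<beta>1 b *\<^sub>R b))"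
        using CI[OF iB] unfolding conic_coefficient_bound_def by blast
      have \<beta>1i: "\<beta>1 i = 0" using i ui by (simp add: \<beta>1_def)
      have "(\<Sum>b\<in>B - {i}. \<beta>1 b *\<^sub>R b) = (\<Sum>b\<in>B. \<beta>1 b *\<^sub>R b)"
        using psubset.hyps(1) iB \<beta>1i by (simp add: sum_diff1)
      also have "\<dots> = (\<Sum>b\<in>B. \<beta> b *\<^sub>R b) - t *\<^sub>R (\<Sum>b\<in>B. u b *\<^sub>R b)"
        by (simp add: \<beta>1_def scaleR_diff_left sum_subtractf scaleR_sum_right)
      finally have eq: "E (\<Sum>b\<in>B - {i}. \<beta>1 b *\<^sub>R b) = E (\<Sum>b\<in>B. \<beta> b *\<^sub>R b)"
        by (simp add: linear_diff[OF E] linear_scale[OF E] u(3))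
      define \<beta>2 where "\<beta>2 = \<beta>'(i := 0)"
      have "(\<Sum>b\<in>B. \<beta>2 b *\<^sub>R b) = (\<Sum>b\<in>B - {i}. \<beta>' b *\<^sub>R b)"
        unfolding \<beta>2_def using psubset.hyps(1) iB by (subst sum.remove[of _ i]) auto
      moreover have "(\<Sum>b\<in>B. \<beta>2 b) = (\<Sum>b\<in>B - {i}. \<beta>' b)"
        unfolding \<beta>2_def using psubset.hyps(1) iB by (subst sum.remove[of _ i]) auto
      moreover have "C i * norm (E (\<Sum>b\<in>B. \<beta> b *\<^sub>R b)) \<le> (1 + sum C B) * norm (E (\<Sum>b\<in>B. \<beta> b *\<^sub>R b))"
        using le[OF iB] by (intro mult_right_mono) auto
      moreover have "\<forall>b\<in>B. 0 \<le> \<beta>2 b" using \<beta>'(1) by (auto simp: \<beta>2_def)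
      ultimately show ?thesis using \<beta>'(2,3) eq by (intro exI[of _ \<beta>2]) auto
    qed
    then have "conic_coefficient_bound E B (1 + sum C B)"
      unfolding conic_coefficient_bound_def by blast
    moreover have "1 + sum C B > 0" using C by (intro add_pos_nonneg sum_nonneg) (auto intro: less_imp_le)
    ultimately show ?thesis by blast
  qed
qed

text \<open>The objective is constant along the kernel of X. Hence in a pairing with the gradient x
  - y may be replaced by any combination with the same image under X.\<close>

lemma gradient_in_kernel:
  fixes A :: "real^'n^'m"
  assumes "GDERIV (logdet_obj A) x :> g" "pos_def (info_mat A x)" "info_mat A z = 0"
  shows "g \<bullet> z = 0"
proof -
  obtain c m where ld: "line_diagonalization A x z c m"
    using line_diagonalization_exists[OF assms(2)] by blast
  have "m i = 0" for i
    using line_diagonalizationD(2)[OF ld, of i] assms(3) by simp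
  then show ?thesis using gradient_along_line[OF assms(1) ld] by simp
qed

text \<open>In contrast to the strongly convex estimate, no uniform bound on X(x) enters. The lemma
  shows that the Frank-Wolfe gap dominates the primal gap, and that the infimum is finite.\<close>

lemma logdet_above_tangent:
  fixes A :: "real^'n^'m"
  assumes g: "GDERIV (logdet_obj A) x :> g" and x: "pos_def (info_mat A x)" and y: "pos_def (info_mat A y)"
  shows "logdet_obj A x + g \<bullet> (y - x) \<le> logdet_obj A y"
proof -
  obtain c m where ld: "line_diagonalization A x (y - x) c m"
    using line_diagonalization_exists[OF x] by blast
  have m: "0 < 1 + m i" for i
    using line_diagonalizationD(4)[OF ld, of 1] y by simp
  have "logdet_obj A y = logdet_obj A x - (\<Sum>i\<in>UNIV. ln (1 + m i))"
    using line_diagonalizationD(5)[OF ld, of 1] m by simp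
  moreover have "(\<Sum>i\<in>UNIV. ln (1 + m i)) \<le> (\<Sum>i\<in>UNIV. m i)"
    using m ln_le_minus_one by (intro sum_mono) fastforce
  ultimately show ?thesis using gradient_along_line[OF g ld] by simp
qed

text \<open>Zero weights on \<open>S\<close> are allowed: the gap bound uses only that \<open>x\<close> lies in the convex hull
  of \<open>S\<close>, and the drop-step count uses only \<open>card S\<close>.\<close>

definition active_representation :: "(real^'m) set \<Rightarrow> real^'m \<Rightarrow> (real^'m) set \<Rightarrow> (real^'m \<Rightarrow> real) \<Rightarrow> bool" where
  "active_representation P x S wt \<longleftrightarrow>
     finite S \<and> S \<subseteq> {v. v extreme_point_of P} \<and> (\<forall>v\<in>S. 0 \<le> wt v) \<and> (\<forall>v. v \<notin> S \<longrightarrow> wt v = 0) \<and>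
     (\<Sum>v\<in>S. wt v) = 1 \<and> x = (\<Sum>v\<in>S. wt v *\<^sub>R v)"

lemma active_representation_mem:
  assumes "convex P" "active_representation P x S wt"
  shows "x \<in> P"
proof -
  have "(\<Sum>v\<in>S. wt v *\<^sub>R v) \<in> P"
    using assms by (intro convex_sum) (auto simp: active_representation_def extreme_point_of_def)
  then show ?thesis using assms by (simp add: active_representation_def)
qed

lemma active_representation_inner_ge:
  assumes "active_representation P x S wt" "\<And>v. v \<in> S \<Longrightarrow> e \<le> g \<bullet> v"
  shows "e \<le> g \<bullet> x"
proof -
  have "e = (\<Sum>v\<in>S. wt v * e)"
    using assms(1) by (simp add: active_representation_def flip: sum_distrib_right)
  also have "\<dots> \<le> (\<Sum>v\<in>S. wt v * (g \<bullet> v))"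
    using assms by (intro sum_mono mult_left_mono) (auto simp: active_representation_def)
  also have "\<dots> = g \<bullet> x"
    using assms(1) by (simp add: active_representation_def inner_sum_right)
  finally show ?thesis .
qed

text \<open>The product of the two families of weights couples \<open>x\<close> with
  \<open>y\<close>: its marginals are the weights of \<open>x\<close> on \<open>S\<close> and of
  \<open>y\<close> on \<open>V\<close>, and x - y is the average of the differences under
  it.\<close>

lemma active_representation_diff_conic:
  fixes V :: "(real^'m) set"
  assumes "finite V" "finite S" "\<forall>v\<in>S. 0 \<le> wt v" "(\<Sum>v\<in>S. wt v) = 1" "x = (\<Sum>v\<in>S. wt v *\<^sub>R v)"
    and y: "y \<in> convex hull V"
  obtains \<beta> where "\<forall>b\<in>(\<lambda>(v, w). v - w) ` (S \<times> V). 0 \<le> \<beta> b"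
    "(\<Sum>b\<in>(\<lambda>(v, w). v - w) ` (S \<times> V). \<beta> b *\<^sub>R b) = x - y"
proof -
  obtain \<eta> where \<eta>: "\<forall>w\<in>V. 0 \<le> \<eta> w" "(\<Sum>w\<in>V. \<eta> w) = 1" "(\<Sum>w\<in>V. \<eta> w *\<^sub>R w) = y"
    using y by (auto simp: convex_hull_finite[OF assms(1)])
  \<comment> \<open>Several pairs may have the same difference; \<open>\<beta>\<close> collects their coefficients.\<close>
  define \<beta> where "\<beta> b = (\<Sum>p | p \<in> S \<times> V \<and> (\<lambda>(v, w). v - w) p = b. wt (fst p) * \<eta> (snd p))" for b
  have "(\<Sum>b\<in>(\<lambda>(v, w). v - w) ` (S \<times> V). \<beta> b *\<^sub>R b)
      = (\<Sum>b\<in>(\<lambda>(v, w). v - w) ` (S \<times> V). \<Sum>p | p \<in> S \<times> V \<and> (\<lambda>(v, w). v - w) p = b.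
          (wt (fst p) * \<eta> (snd p)) *\<^sub>R (fst p - snd p))"
    unfolding \<beta>_def scaleR_sum_left by (intro sum.cong refl) auto
  also have "\<dots> = (\<Sum>p\<in>S \<times> V. (wt (fst p) * \<eta> (snd p)) *\<^sub>R (fst p - snd p))"
    using assms(1,2) by (intro sum.image_gen[symmetric]) auto
  also have "\<dots> = (\<Sum>v\<in>S. \<Sum>w\<in>V. (wt v * \<eta> w) *\<^sub>R (v - w))"
    by (simp add: sum.cartesian_product case_prod_beta)
  also have "\<dots> = (\<Sum>v\<in>S. wt v *\<^sub>R (v - y))"
  proof (intro sum.cong refl)
    fix v
    have "(\<Sum>w\<in>V. (wt v * \<eta> w) *\<^sub>R (v - w)) = wt v *\<^sub>R (\<Sum>w\<in>V. \<eta> w *\<^sub>R v - \<eta> w *\<^sub>R w)"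
      by (simp add: scaleR_sum_right scaleR_diff_right)
    also have "(\<Sum>w\<in>V. \<eta> w *\<^sub>R v - \<eta> w *\<^sub>R w) = v - y"
      by (simp add: sum_subtractf \<eta> flip: scaleR_sum_left)
    finally show "(\<Sum>w\<in>V. (wt v * \<eta> w) *\<^sub>R (v - w)) = wt v *\<^sub>R (v - y)" .
  qed
  also have "\<dots> = x - y"
    by (simp add: scaleR_diff_right sum_subtractf assms flip: scaleR_sum_left)
  finally have eq: "(\<Sum>b\<in>(\<lambda>(v, w). v - w) ` (S \<times> V). \<beta> b *\<^sub>R b) = x - y" .
  have nn: "\<forall>b\<in>(\<lambda>(v, w). v - w) ` (S \<times> V). 0 \<le> \<beta> b"
    unfolding \<beta>_def using assms(3) \<eta>(1) by (auto intro!: sum_nonneg)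
  show thesis by (rule that[OF nn eq])
qed

text \<open>With \<open>e\<close> the norm of X(x - y) and \<open>G = g \<bullet> (a - w)\<close>,
  the conic bound gives \<open>g \<bullet> (x - y) \<le> C0 * e * G\<close>, and strong convexity
  subtracts \<open>\<kappa> * e\<^sup>2\<close>. Completing the square removes the unknown
  \<open>e\<close> and leaves the constant \<open>C0\<^sup>2 / (4 * \<kappa>)\<close>.\<close>

lemma primal_gap_le_strong_gap_squared:
  fixes A :: "real^'n^'m"
  assumes P: "polytope P" and B: "0 \<le> B" "\<And>x. x \<in> P \<Longrightarrow> (\<Sum>i\<in>UNIV. \<bar>x $ i\<bar>) \<le> B" and \<alpha>: "0 < \<alpha>"
  shows "\<exists>K>0. \<forall>x S wt g a w y. active_representation P x S wt \<longrightarrow>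
    GDERIV (logdet_obj A) x :> g \<longrightarrow> pos_def (info_mat A x) \<longrightarrow>
    (\<forall>z. \<alpha> * (norm z)\<^sup>2 \<le> z \<bullet> (info_mat A x *v z)) \<longrightarrow>
    a \<in> S \<longrightarrow> (\<forall>v\<in>S. g \<bullet> v \<le> g \<bullet> a) \<longrightarrow> (\<forall>v\<in>P. g \<bullet> w \<le> g \<bullet> v) \<longrightarrow>
    y \<in> P \<longrightarrow> pos_def (info_mat A y) \<longrightarrow>
    logdet_obj A x - logdet_obj A y \<le> K * (g \<bullet> (a - w))\<^sup>2"
proof -
  define V where "V = {v. v extreme_point_of P}"
  have VP: "V \<subseteq> P" by (auto simp: V_def extreme_point_of_def)
  have fV: "finite V"
    unfolding V_def using P by (intro finite_polyhedron_extreme_points polytope_imp_polyhedron)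
  have hull: "P = convex hull V"
    unfolding V_def using P by (intro Krein_Milman_Minkowski polytope_imp_compact polytope_imp_convex)
  define D where "D S = (\<lambda>(v, w). v - w) ` (S \<times> V)" for S
  have "\<exists>C>0. conic_coefficient_bound (info_mat A) (D S) C" if "S \<in> Pow V" for S
    using that fV by (intro conic_coefficient_bound_exists linear_info_mat)
      (auto simp: D_def intro: finite_subset)
  then obtain C where C: "\<And>S. S \<in> Pow V \<Longrightarrow> C S > 0"
    and CD: "\<And>S. S \<in> Pow V \<Longrightarrow> conic_coefficient_bound (info_mat A) (D S) (C S)"
    by metis
  \<comment> \<open>Finitely many vertices have finitely many subsets, so one constant covers every
    possible active set.\<close>
  define C0 where "C0 = 1 + sum C (Pow V)"
  have C0: "C0 > 0"
    unfolding C0_def using C by (intro add_pos_nonneg sum_nonneg) (auto intro: less_imp_le)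
  have CC0: "C S \<le> C0" if "S \<in> Pow V" for S
  proof -
    have "C S \<le> sum C (Pow V)"
      using that fV by (intro member_le_sum) (auto intro: less_imp_le[OF C])
    then show ?thesis by (simp add: C0_def)
  qed
  obtain \<kappa> where \<kappa>: "\<kappa> > 0" and conv: "\<And>x y g. GDERIV (logdet_obj A) x :> g \<Longrightarrow> pos_def (info_mat A x) \<Longrightarrow>
    pos_def (info_mat A y) \<Longrightarrow> (\<forall>z. \<alpha> * (norm z)\<^sup>2 \<le> z \<bullet> (info_mat A x *v z)) \<Longrightarrow>
    (\<Sum>i\<in>UNIV. \<bar>x $ i\<bar>) \<le> B \<Longrightarrow> (\<Sum>i\<in>UNIV. \<bar>y $ i\<bar>) \<le> B \<Longrightarrow>
    logdet_obj A x + g \<bullet> (y - x) + \<kappa> * (norm (info_mat A (y - x)))\<^sup>2 \<le> logdet_obj A y"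
    using logdet_strongly_convex[OF \<alpha> B(1), of A] by metis
  show ?thesis
  proof (intro exI[of _ "C0\<^sup>2 / (4 * \<kappa>)"] conjI allI impI)
    show "0 < C0\<^sup>2 / (4 * \<kappa>)" using C0 \<kappa> by simp
    fix x S wt g a w y
    assume rep: "active_representation P x S wt" and g: "GDERIV (logdet_obj A) x :> g"
      and x: "pos_def (info_mat A x)" and lam: "\<forall>z. \<alpha> * (norm z)\<^sup>2 \<le> z \<bullet> (info_mat A x *v z)"
      and a: "a \<in> S" "\<forall>v\<in>S. g \<bullet> v \<le> g \<bullet> a" and w: "\<forall>v\<in>P. g \<bullet> w \<le> g \<bullet> v"
      and y: "y \<in> P" "pos_def (info_mat A y)"
    have SV: "S \<in> Pow V" using rep by (auto simp: active_representation_def V_def)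
    have xP: "x \<in> P" using active_representation_mem[OF polytope_imp_convex[OF P] rep] .
    have "finite S" "\<forall>v\<in>S. 0 \<le> wt v" "(\<Sum>v\<in>S. wt v) = 1" "x = (\<Sum>v\<in>S. wt v *\<^sub>R v)" "y \<in> convex hull V"
      using rep y hull by (auto simp: active_representation_def)
    from active_representation_diff_conic[OF fV this]
    obtain \<beta> where \<beta>: "\<forall>b\<in>D S. 0 \<le> \<beta> b" "(\<Sum>b\<in>D S. \<beta> b *\<^sub>R b) = x - y"
      unfolding D_def by blast
    then obtain \<beta>' where \<beta>': "\<forall>b\<in>D S. 0 \<le> \<beta>' b" "info_mat A (\<Sum>b\<in>D S. \<beta>' b *\<^sub>R b) = info_mat A (x - y)"
      "(\<Sum>b\<in>D S. \<beta>' b) \<le> C S * norm (info_mat A (x - y))"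
      using CD[OF SV, unfolded conic_coefficient_bound_def, rule_format, of \<beta>] by (auto simp: \<beta>(2))
    define G where "G = g \<bullet> (a - w)"
    define e where "e = norm (info_mat A (x - y))"
    have G0: "G \<ge> 0" using a SV VP w by (auto simp: G_def inner_diff_right)
    have "g \<bullet> ((\<Sum>b\<in>D S. \<beta>' b *\<^sub>R b) - (x - y)) = 0"
      using \<beta>'(2) by (intro gradient_in_kernel[OF g x]) (simp add: linear_diff[OF linear_info_mat])
    then have "g \<bullet> (x - y) = (\<Sum>b\<in>D S. \<beta>' b * (g \<bullet> b))"
      by (simp add: inner_diff_right inner_sum_right)
    also have "\<dots> \<le> (\<Sum>b\<in>D S. \<beta>' b * G)"
    proof (intro sum_mono mult_left_mono)
      fix b assume "b \<in> D S"
      then obtain v w' where "b = v - w'" "v \<in> S" "w' \<in> V" by (auto simp: D_def)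
      then show "g \<bullet> b \<le> G"
        using a(2)[rule_format, of v] w[rule_format, of w'] VP
        by (auto simp: G_def inner_diff_right intro!: diff_mono)
      show "0 \<le> \<beta>' b" using \<beta>'(1) \<open>b \<in> D S\<close> by blast
    qed
    also have "\<dots> \<le> (C S * e) * G"
      unfolding sum_distrib_right[symmetric] e_def using \<beta>'(3) G0 by (rule mult_right_mono)
    also have "\<dots> \<le> (C0 * e) * G"
      using CC0[OF SV] G0 by (intro mult_right_mono) (auto simp: e_def)
    finally have 1: "g \<bullet> (x - y) \<le> C0 * e * G" .
    have "norm (info_mat A (y - x)) = e"
      unfolding e_def by (metis linear_diff[OF linear_info_mat] norm_minus_commute)
    then have "logdet_obj A x - logdet_obj A y \<le> g \<bullet> (x - y) - \<kappa> * e\<^sup>2"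
      using conv[OF g x y(2) lam] B(2) xP y(1) by (force simp: inner_diff_right)
    also have "\<dots> \<le> C0 * e * G - \<kappa> * e\<^sup>2" using 1 by simp
    also have "\<dots> = C0\<^sup>2 / (4 * \<kappa>) * G\<^sup>2 - \<kappa> * (e - C0 * G / (2 * \<kappa>))\<^sup>2"
      using \<kappa> by (simp add: power2_eq_square field_simps)
    also have "\<dots> \<le> C0\<^sup>2 / (4 * \<kappa>) * G\<^sup>2" using \<kappa> by simp
    finally show "logdet_obj A x - logdet_obj A y \<le> C0\<^sup>2 / (4 * \<kappa>) * (g \<bullet> (a - w))\<^sup>2"
      by (simp add: G_def)
  qed
qed

section \<open>Exact line search\<close>

lemma line_search_le:
  assumes "line_search A x d gmax \<gamma>" "0 \<le> r" "r \<le> gmax" "pos_def (info_mat A (x - r *\<^sub>R d))"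
  shows "pos_def (info_mat A (x - \<gamma> *\<^sub>R d))" "logdet_obj A (x - \<gamma> *\<^sub>R d) \<le> logdet_obj A (x - r *\<^sub>R d)"
proof -
  have "dopt_obj A (x - \<gamma> *\<^sub>R d) \<le> dopt_obj A (x - r *\<^sub>R d)"
    using assms(1-3) by (auto simp: line_search_def is_arg_min_linorder)
  then show "pos_def (info_mat A (x - \<gamma> *\<^sub>R d))" "logdet_obj A (x - \<gamma> *\<^sub>R d) \<le> logdet_obj A (x - r *\<^sub>R d)"
    using assms(4) by (auto simp: dopt_obj_def split: if_splits)
qed

lemma line_search_range:
  assumes "line_search A x d gmax \<gamma>"
  shows "0 \<le> \<gamma>" "\<gamma> \<le> gmax"
  using assms by (auto simp: line_search_def is_arg_min_def)

text \<open>By convexity a minimizer strictly below the end of the segment also beats the points of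
  the ray beyond the segment. A step that stops before its limit is therefore at least as good as
  the unrestricted step, however small \<open>gmax\<close> is.\<close>

lemma interior_line_search_le:
  fixes A :: "real^'n^'m"
  assumes ls: "line_search A x d gmax \<gamma>" and less: "\<gamma> < gmax" and x: "pos_def (info_mat A x)"
    and r: "0 \<le> r" "pos_def (info_mat A (x - r *\<^sub>R d))"
  shows "logdet_obj A (x - \<gamma> *\<^sub>R d) \<le> logdet_obj A (x - r *\<^sub>R d)"
proof (cases "r \<le> gmax")
  case True
  then show ?thesis using line_search_le[OF ls r(1) _ r(2)] by blast
next
  case False
  have pd: "pos_def (info_mat A (x - \<gamma> *\<^sub>R d))"
    using line_search_le(1)[OF ls, of 0] line_search_range[OF ls] x less by simp
  \<comment> \<open>This \<open>t\<close> makes the end \<open>gmax\<close> a convex combination of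
    \<open>\<gamma>\<close> and \<open>r\<close>.\<close>
  define t where "t = (gmax - \<gamma>) / (r - \<gamma>)"
  have t: "0 < t" "t < 1" using False less by (auto simp: t_def)
  have eq: "(1 - t) *\<^sub>R (x - \<gamma> *\<^sub>R d) + t *\<^sub>R (x - r *\<^sub>R d) = x - gmax *\<^sub>R d"
  proof -
    have "(1 - t) * \<gamma> + t * r = \<gamma> + t * (r - \<gamma>)" by (simp add: algebra_simps)
    also have "\<dots> = gmax" using False less by (simp add: t_def)
    finally have "(1 - t) * \<gamma> + t * r = gmax" .
    moreover have "(1 - t) *\<^sub>R (x - \<gamma> *\<^sub>R d) + t *\<^sub>R (x - r *\<^sub>R d) = x - ((1 - t) * \<gamma> + t * r) *\<^sub>R d"
      by (simp add: algebra_simps)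
    ultimately show ?thesis by simp
  qed
  have pdm: "pos_def (info_mat A (x - gmax *\<^sub>R d))"
    unfolding eq[symmetric] using pd r(2) t by (intro pos_def_info_mat_convex) auto
  have "logdet_obj A (x - \<gamma> *\<^sub>R d) \<le> logdet_obj A (x - gmax *\<^sub>R d)"
    using line_search_le(2)[OF ls _ _ pdm] line_search_range[OF ls] by simp
  also have "\<dots> \<le> (1 - t) * logdet_obj A (x - \<gamma> *\<^sub>R d) + t * logdet_obj A (x - r *\<^sub>R d)"
    unfolding eq[symmetric] using pd r(2) t by (intro logdet_convex) auto
  finally have "t * logdet_obj A (x - \<gamma> *\<^sub>R d) \<le> t * logdet_obj A (x - r *\<^sub>R d)"
    by (simp add: algebra_simps)
  then show ?thesis using t by simp
qed

section \<open>Progress of one step\<close>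

text \<open>A vertex is removed only when its new weight is 0, so sums over the old and the new
  active set agree; for \<open>a = s\<close> the two corrections cancel.\<close>

lemma active_representation_pairwise:
  assumes rep: "active_representation P x S wt" and as: "a \<in> S" "s \<in> S" and \<gamma>: "0 \<le> \<gamma>" "\<gamma> \<le> wt a"
  shows "active_representation P (x - \<gamma> *\<^sub>R (a - s)) (if \<gamma> = wt a \<and> a \<noteq> s then S - {a} else S)
    (\<lambda>v. wt v - (if v = a then \<gamma> else 0) + (if v = s then \<gamma> else 0))"
proof -
  let ?wt = "\<lambda>v. wt v - (if v = a then \<gamma> else 0) + (if v = s then \<gamma> else 0)"
  let ?S = "if \<gamma> = wt a \<and> a \<noteq> s then S - {a} else S"
  have fin: "finite S" and nn: "\<And>v. v \<in> S \<Longrightarrow> 0 \<le> wt v" and off: "\<And>v. v \<notin> S \<Longrightarrow> wt v = 0"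
    and sum1: "(\<Sum>v\<in>S. wt v) = 1" and x: "x = (\<Sum>v\<in>S. wt v *\<^sub>R v)" and SP: "S \<subseteq> {v. v extreme_point_of P}"
    using rep by (auto simp: active_representation_def)
  have wta: "?wt a = 0" if "\<gamma> = wt a \<and> a \<noteq> s" using that by simp
  have shift1: "(\<Sum>v\<in>?S. ?wt v) = (\<Sum>v\<in>S. ?wt v)"
  proof (cases "\<gamma> = wt a \<and> a \<noteq> s")
    case True
    then have "(\<Sum>v\<in>S. ?wt v) = ?wt a + (\<Sum>v\<in>S - {a}. ?wt v)"
      using fin as by (intro sum.remove) auto
    then show ?thesis using True by simp
  qed auto
  have "(\<Sum>v\<in>?S. ?wt v *\<^sub>R v) = (\<Sum>v\<in>S. ?wt v *\<^sub>R v)"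
  proof (cases "\<gamma> = wt a \<and> a \<noteq> s")
    case True
    then have "(\<Sum>v\<in>S. ?wt v *\<^sub>R v) = ?wt a *\<^sub>R a + (\<Sum>v\<in>S - {a}. ?wt v *\<^sub>R v)"
      using fin as by (intro sum.remove) auto
    then show ?thesis using True by simp
  qed auto
  also have "\<dots> = (\<Sum>v\<in>S. wt v *\<^sub>R v - (if v = a then \<gamma> *\<^sub>R a else 0) + (if v = s then \<gamma> *\<^sub>R s else 0))"
    by (intro sum.cong) (auto simp: algebra_simps)
  also have "\<dots> = x - \<gamma> *\<^sub>R (a - s)"
    using fin as by (simp add: sum.distrib sum_subtractf x algebra_simps)
  finally have shift2: "(\<Sum>v\<in>?S. ?wt v *\<^sub>R v) = x - \<gamma> *\<^sub>R (a - s)" .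
  have "(\<Sum>v\<in>S. ?wt v) = 1"
    using fin as sum1 by (simp add: sum.distrib sum_subtractf)
  then have sum1': "(\<Sum>v\<in>?S. ?wt v) = 1" by (simp only: shift1)
  have nn': "\<forall>v\<in>?S. 0 \<le> ?wt v"
  proof
    fix v assume "v \<in> ?S"
    then have "v \<in> S" by (simp split: if_splits)
    then show "0 \<le> ?wt v" using nn[of v] \<gamma> by simp
  qed
  have off': "\<forall>v. v \<notin> ?S \<longrightarrow> ?wt v = 0"
  proof (intro allI impI)
    fix v assume v: "v \<notin> ?S"
    show "?wt v = 0"
    proof (cases "v \<in> S")
      case True
      then have "v = a \<and> \<gamma> = wt a \<and> a \<noteq> s" using v by (simp split: if_splits)
      then show ?thesis by simp
    next
      case False
      then have "v \<noteq> a" "v \<noteq> s" using as by auto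
      then show ?thesis using off[OF False] by simp
    qed
  qed
  have fin': "finite ?S" and SP': "?S \<subseteq> {v. v extreme_point_of P}" using fin SP by auto
  show ?thesis
    unfolding active_representation_def by (intro conjI fin' SP' nn' off' sum1' shift2[symmetric])
qed

lemma active_representation_frank_wolfe:
  assumes rep: "active_representation P x S wt" and w: "w extreme_point_of P" and \<gamma>: "0 \<le> \<gamma>" "\<gamma> \<le> 1"
  shows "active_representation P (x - \<gamma> *\<^sub>R (x - w)) (if \<gamma> = 1 then {w} else insert w S)
    (\<lambda>v. (1 - \<gamma>) * wt v + (if v = w then \<gamma> else 0))"
proof (cases "\<gamma> = 1")
  case True
  then show ?thesis using w by (simp add: active_representation_def)
next
  case False
  let ?wt = "\<lambda>v. (1 - \<gamma>) * wt v + (if v = w then \<gamma> else 0)"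
  have fin: "finite S" and nn: "\<And>v. v \<in> S \<Longrightarrow> 0 \<le> wt v" and off: "\<And>v. v \<notin> S \<Longrightarrow> wt v = 0"
    and sum1: "(\<Sum>v\<in>S. wt v) = 1" and x: "x = (\<Sum>v\<in>S. wt v *\<^sub>R v)" and SP: "S \<subseteq> {v. v extreme_point_of P}"
    using rep by (auto simp: active_representation_def)
  \<comment> \<open>Whether or not \<open>w\<close> lies in \<open>S\<close>, inserting it changes
    neither sum, as weights vanish off \<open>S\<close>.\<close>
  have "(\<Sum>v\<in>insert w S. wt v) = 1" "(\<Sum>v\<in>insert w S. wt v *\<^sub>R v) = x"
    using fin off sum1 x by (auto simp: sum.insert_if)
  note ins = this
  have "(\<Sum>v\<in>insert w S. ?wt v) = (1 - \<gamma>) * (\<Sum>v\<in>insert w S. wt v) + \<gamma>"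
    using fin by (simp only: sum.distrib sum_distrib_left) simp
  then have 1: "(\<Sum>v\<in>insert w S. ?wt v) = 1" by (simp add: ins)
  have "(\<Sum>v\<in>insert w S. ?wt v *\<^sub>R v) = (\<Sum>v\<in>insert w S. (1 - \<gamma>) *\<^sub>R (wt v *\<^sub>R v) + (if v = w then \<gamma> *\<^sub>R w else 0))"
    by (intro sum.cong) (auto simp: algebra_simps)
  also have "\<dots> = (1 - \<gamma>) *\<^sub>R (\<Sum>v\<in>insert w S. wt v *\<^sub>R v) + \<gamma> *\<^sub>R w"
    using fin by (simp only: sum.distrib scaleR_sum_right) simp
  also have "\<dots> = x - \<gamma> *\<^sub>R (x - w)"
    by (simp only: ins) (simp add: algebra_simps)
  finally have 2: "(\<Sum>v\<in>insert w S. ?wt v *\<^sub>R v) = x - \<gamma> *\<^sub>R (x - w)" .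
  have "\<forall>v\<in>insert w S. 0 \<le> ?wt v"
    using nn off \<gamma> by (metis add_nonneg_nonneg diff_ge_0_iff_ge mult_nonneg_nonneg order_refl)
  moreover have "\<forall>v. v \<notin> insert w S \<longrightarrow> ?wt v = 0"
    using off by auto
  ultimately show ?thesis
    using False fin SP w 1 2 unfolding active_representation_def by auto
qed

lemma sum_abs_diff_le:
  fixes p q :: "real^'m"
  assumes "(\<Sum>i\<in>UNIV. \<bar>p $ i\<bar>) \<le> B" "(\<Sum>i\<in>UNIV. \<bar>q $ i\<bar>) \<le> B"
  shows "(\<Sum>i\<in>UNIV. \<bar>(p - q) $ i\<bar>) \<le> 2 * B"
proof -
  have "(\<Sum>i\<in>UNIV. \<bar>(p - q) $ i\<bar>) \<le> (\<Sum>i\<in>UNIV. \<bar>p $ i\<bar> + \<bar>q $ i\<bar>)"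
    by (intro sum_mono) (simp add: abs_triangle_ineq4)
  then show ?thesis using assms by (simp add: sum.distrib)
qed

text \<open>The two conditions on \<open>e\<close> say that it is the infimum of the objective over the domain-feasible
  points, without presupposing that this infimum is finite.\<close>

definition gap_contracts ::
    "real^'n^'m \<Rightarrow> (real^'m) set \<Rightarrow> real \<Rightarrow> real^'m \<Rightarrow> real^'m \<Rightarrow> bool" where
  "gap_contracts A P \<rho> x x' \<longleftrightarrow>
     (\<forall>e. (\<forall>y\<in>P. pos_def (info_mat A y) \<longrightarrow> e \<le> logdet_obj A y) \<and>
          (\<forall>e'. (\<forall>y\<in>P. pos_def (info_mat A y) \<longrightarrow> e' \<le> logdet_obj A y) \<longrightarrow> e' \<le> e) \<longrightarrow>
          logdet_obj A x' - e \<le> (1 - \<rho>) * (logdet_obj A x - e))"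

text \<open>The second alternative is a drop step, whose progress is limited by the weight of
  \<open>a\<close>. A Frank-Wolfe step of full length falls under the first: its limit is 1, and the
  resulting bound \<open>G / 2\<close> is at least half the primal gap, because the Frank-Wolfe gap
  dominates the primal gap.\<close>

lemma bpcg_step_contracts:
  fixes A :: "real^'n^'m"
  assumes P: "polytope P" and B: "0 \<le> B" "\<And>x. x \<in> P \<Longrightarrow> (\<Sum>i\<in>UNIV. \<bar>x $ i\<bar>) \<le> B"
    and \<alpha>: "0 < \<alpha>" and \<delta>: "0 < \<delta>"
  shows "\<exists>\<rho>>0. \<rho> < 1 \<and> (\<forall>x S wt x' S' wt'. bpcg_step A P (x, S, wt) (x', S', wt') \<longrightarrow>
    active_representation P x S wt \<longrightarrow> pos_def (info_mat A x) \<longrightarrow>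
    (\<forall>z. \<alpha> * (norm z)\<^sup>2 \<le> z \<bullet> (info_mat A x *v z)) \<longrightarrow>
    active_representation P x' S' wt' \<and> pos_def (info_mat A x') \<and> logdet_obj A x' \<le> logdet_obj A x \<and>
    (card S' \<le> Suc (card S) \<and> gap_contracts A P \<rho> x x' \<or>
     Suc (card S') \<le> card S \<and> ((\<forall>v\<in>S. \<delta> \<le> wt v) \<longrightarrow> gap_contracts A P \<rho> x x')))"
proof -
  obtain K where K: "K > 0" and strong: "\<And>x S wt g a w y. active_representation P x S wt \<Longrightarrow>
    GDERIV (logdet_obj A) x :> g \<Longrightarrow> pos_def (info_mat A x) \<Longrightarrow>
    (\<forall>z. \<alpha> * (norm z)\<^sup>2 \<le> z \<bullet> (info_mat A x *v z)) \<Longrightarrow>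
    a \<in> S \<Longrightarrow> (\<forall>v\<in>S. g \<bullet> v \<le> g \<bullet> a) \<Longrightarrow> (\<forall>v\<in>P. g \<bullet> w \<le> g \<bullet> v) \<Longrightarrow>
    y \<in> P \<Longrightarrow> pos_def (info_mat A y) \<Longrightarrow>
    logdet_obj A x - logdet_obj A y \<le> K * (g \<bullet> (a - w))\<^sup>2"
    using primal_gap_le_strong_gap_squared[OF P B \<alpha>, of A] by metis
  have B2: "0 \<le> 2 * B" using B(1) by simp
  obtain L where L: "L > 0" and descent: "\<And>x d g r. GDERIV (logdet_obj A) x :> g \<Longrightarrow> pos_def (info_mat A x) \<Longrightarrow>
    (\<forall>z. \<alpha> * (norm z)\<^sup>2 \<le> z \<bullet> (info_mat A x *v z)) \<Longrightarrow>
    (\<Sum>i\<in>UNIV. \<bar>d $ i\<bar>) \<le> 2 * B \<Longrightarrow> 0 \<le> r \<Longrightarrow> r \<le> (g \<bullet> d) / (2 * L) \<Longrightarrow>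
    pos_def (info_mat A (x - r *\<^sub>R d)) \<and>
    logdet_obj A (x - r *\<^sub>R d) \<le> logdet_obj A x - r * (g \<bullet> d) + L * r\<^sup>2"
    using logdet_descent[OF \<alpha> B2, of A] by metis
  \<comment> \<open>One entry for each bound on the progress: 1/2 for the limit 1 of a Frank-Wolfe
    step, \<open>\<delta>/2\<close> for the limit \<open>wt a\<close> of a drop step, and the last
    from a primal gap of at most \<open>4 * K * G\<^sup>2\<close> against a gain of
    \<open>G\<^sup>2 / (4 * L)\<close>.\<close>
  define \<rho> where "\<rho> = min (1/2) (min (\<delta>/2) (1 / (16 * K * L)))"
  have \<rho>: "\<rho> > 0" "\<rho> < 1" "\<rho> \<le> 1/2" "\<rho> \<le> \<delta>/2" "\<rho> \<le> 1 / (16 * K * L)"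
    using K L \<delta> by (auto simp: \<rho>_def)
  show ?thesis
  proof (rule exI[of _ \<rho>], rule conjI[OF \<rho>(1)], rule conjI[OF \<rho>(2)], intro allI impI)
    fix x S wt x' S' wt'
    assume step: "bpcg_step A P (x, S, wt) (x', S', wt')" and rep: "active_representation P x S wt"
      and x: "pos_def (info_mat A x)" and lam: "\<forall>z. \<alpha> * (norm z)\<^sup>2 \<le> z \<bullet> (info_mat A x *v z)"
    have xP: "x \<in> P" using active_representation_mem[OF polytope_imp_convex[OF P] rep] .
    have fin: "finite S" and SP: "S \<subseteq> P"
      using rep by (auto simp: active_representation_def extreme_point_of_def)
    \<comment> \<open>The search is compared with the minimizer \<open>G / (2 * L)\<close> of the
      quadratic bound if this is admissible, and otherwise with \<open>gmax\<close>, where the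
      quadratic term costs at most half of the linear gain. A search that stops before
      \<open>gmax\<close> attains the full gain in either case.\<close>
    have descends: "pos_def (info_mat A (x - \<gamma> *\<^sub>R d)) \<and>
        logdet_obj A (x - \<gamma> *\<^sub>R d) \<le> logdet_obj A x - min (gmax * (g \<bullet> d) / 2) ((g \<bullet> d)\<^sup>2 / (4 * L)) \<and>
        (\<gamma> < gmax \<longrightarrow> logdet_obj A (x - \<gamma> *\<^sub>R d) \<le> logdet_obj A x - (g \<bullet> d)\<^sup>2 / (4 * L))"
      if g: "GDERIV (logdet_obj A) x :> g" and dB: "(\<Sum>i\<in>UNIV. \<bar>d $ i\<bar>) \<le> 2 * B" and G: "0 \<le> g \<bullet> d"
        and ls: "line_search A x d gmax \<gamma>" and gmax: "0 \<le> gmax" for g d gmax \<gamma>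
    proof -
      define G where "G = g \<bullet> d"
      define rs where "rs = G / (2 * L)"
      have rs0: "0 \<le> rs" using G L by (simp add: rs_def G_def)
      have full: "pos_def (info_mat A (x - rs *\<^sub>R d)) \<and> logdet_obj A (x - rs *\<^sub>R d) \<le> logdet_obj A x - G\<^sup>2 / (4 * L)"
      proof -
        have "- rs * G + L * rs\<^sup>2 = - (G\<^sup>2 / (4 * L))"
          using L by (simp add: rs_def power2_eq_square field_simps)
        then show ?thesis
          using descent[OF g x lam dB rs0] by (simp add: rs_def G_def[symmetric])
      qed
      have 3: "logdet_obj A (x - \<gamma> *\<^sub>R d) \<le> logdet_obj A x - G\<^sup>2 / (4 * L)" if "\<gamma> < gmax"
        using interior_line_search_le[OF ls that x rs0] full by linarith
      have "pos_def (info_mat A (x - \<gamma> *\<^sub>R d)) \<and>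
        logdet_obj A (x - \<gamma> *\<^sub>R d) \<le> logdet_obj A x - min (gmax * G / 2) (G\<^sup>2 / (4 * L))"
      proof (cases "rs \<le> gmax")
        case True
        then show ?thesis using line_search_le[OF ls rs0 True] full by fastforce
      next
        case False
        have r: "pos_def (info_mat A (x - gmax *\<^sub>R d)) \<and>
          logdet_obj A (x - gmax *\<^sub>R d) \<le> logdet_obj A x - gmax * G + L * gmax\<^sup>2"
          using descent[OF g x lam dB gmax] False by (simp add: rs_def G_def)
        have "gmax * (L * gmax) \<le> gmax * (G / 2)"
          using False L gmax by (intro mult_left_mono) (auto simp: rs_def field_simps)
        then have "L * gmax\<^sup>2 \<le> gmax * G / 2" by (simp add: power2_eq_square mult_ac)
        then show ?thesis using r line_search_le[OF ls gmax order_refl] by fastforce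
      qed
      with 3 show ?thesis by (simp add: G_def)
    qed
    \<comment> \<open>The factor 4 is the square of the 2 in
      \<open>g \<bullet> (a - w) \<le> 2 * G\<close>. Both upper bounds come from lower bounds valid
      for every feasible competitor, hence also for \<open>e\<close>.\<close>
    have gap: "logdet_obj A x - e \<le> 4 * K * G\<^sup>2 \<and> logdet_obj A x - e \<le> g \<bullet> (x - w) \<and> 0 \<le> logdet_obj A x - e"
      if g: "GDERIV (logdet_obj A) x :> g" and a: "a \<in> S" "\<forall>v\<in>S. g \<bullet> v \<le> g \<bullet> a"
        and w: "\<forall>v\<in>P. g \<bullet> w \<le> g \<bullet> v" and G: "g \<bullet> (a - w) \<le> 2 * G"
        and e: "\<forall>y\<in>P. pos_def (info_mat A y) \<longrightarrow> e \<le> logdet_obj A y"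
          "\<forall>e'. (\<forall>y\<in>P. pos_def (info_mat A y) \<longrightarrow> e' \<le> logdet_obj A y) \<longrightarrow> e' \<le> e"
      for g a w G e
    proof (intro conjI)
      have "logdet_obj A x - K * (g \<bullet> (a - w))\<^sup>2 \<le> e"
        using strong[OF rep g x lam a w] by (intro e(2)[rule_format]) (simp add: algebra_simps)
      moreover have "(g \<bullet> (a - w))\<^sup>2 \<le> (2 * G)\<^sup>2"
        using G a SP w by (intro power_mono) (auto simp: inner_diff_right)
      then have "K * (g \<bullet> (a - w))\<^sup>2 \<le> K * (2 * G)\<^sup>2" using K by simp
      ultimately show "logdet_obj A x - e \<le> 4 * K * G\<^sup>2" by (simp add: power_mult_distrib)
      have "logdet_obj A x - g \<bullet> (x - w) \<le> logdet_obj A y" if y: "y \<in> P" "pos_def (info_mat A y)" for y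
        using logdet_above_tangent[OF g x y(2)] w y(1) by (fastforce simp: inner_diff_right)
      then have "logdet_obj A x - g \<bullet> (x - w) \<le> e"
        by (intro e(2)[rule_format])
      then show "logdet_obj A x - e \<le> g \<bullet> (x - w)" by simp
      show "0 \<le> logdet_obj A x - e" using e(1) xP x by simp
    qed
    have quad_contract: "\<rho> * h \<le> G\<^sup>2 / (4 * L)" if "h \<le> 4 * K * G\<^sup>2" "0 \<le> h" for h G
    proof -
      have "\<rho> * h \<le> 1 / (16 * K * L) * h" using that \<rho> by (intro mult_right_mono) auto
      also have "\<dots> \<le> 1 / (16 * K * L) * (4 * K * G\<^sup>2)" using that K L by (intro mult_left_mono) auto
      also have "\<dots> = G\<^sup>2 / (4 * L)" using K L by (simp add: field_simps)
      finally show ?thesis .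
    qed
    show "active_representation P x' S' wt' \<and> pos_def (info_mat A x') \<and> logdet_obj A x' \<le> logdet_obj A x \<and>
      (card S' \<le> Suc (card S) \<and> gap_contracts A P \<rho> x x' \<or>
       Suc (card S') \<le> card S \<and> ((\<forall>v\<in>S. \<delta> \<le> wt v) \<longrightarrow> gap_contracts A P \<rho> x x'))"
      using step
    proof cases
      case (pairwise g a s w \<gamma>)
      note x' = pairwise(1) and S' = pairwise(2) and wt' = pairwise(3)
      have a: "a \<in> S" "\<forall>v\<in>S. g \<bullet> v \<le> g \<bullet> a" using pairwise(5) by (auto simp: is_arg_max_linorder)
      have s: "s \<in> S" "\<And>v. v \<in> S \<Longrightarrow> g \<bullet> s \<le> g \<bullet> v" using pairwise(6) by (auto simp: is_arg_min_linorder)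
      have w: "\<forall>v\<in>P. g \<bullet> w \<le> g \<bullet> v" using pairwise(8) by (auto simp: is_arg_min_linorder)
      note g = pairwise(4) and dir = pairwise(9) and ls = pairwise(10)
      have \<gamma>: "0 \<le> \<gamma>" "\<gamma> \<le> wt a" using line_search_range[OF ls] by auto
      define G where "G = g \<bullet> (a - s)"
      have G0: "0 \<le> G" using a s by (simp add: G_def inner_diff_right)
      \<comment> \<open>Since \<open>g \<bullet> s \<le> g \<bullet> x\<close>, the value
        \<open>g \<bullet> (a - w)\<close> is at most the sum of \<open>g \<bullet> (a - s)\<close>
        and \<open>g \<bullet> (x - w)\<close>, and the selection rule takes the larger of the
        two.\<close>
      have Gs: "g \<bullet> (a - w) \<le> 2 * G"
        using dir active_representation_inner_ge[OF rep s(2)] by (simp add: G_def inner_diff_right)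
      have dB: "(\<Sum>i\<in>UNIV. \<bar>(a - s) $ i\<bar>) \<le> 2 * B"
        using a(1) s(1) SP B(2) by (intro sum_abs_diff_le) auto
      note D = descends[OF g dB _ ls, folded G_def x', OF G0]
      have D: "pos_def (info_mat A x')" "logdet_obj A x' \<le> logdet_obj A x - min (wt a * G / 2) (G\<^sup>2 / (4 * L))"
        "\<gamma> < wt a \<Longrightarrow> logdet_obj A x' \<le> logdet_obj A x - G\<^sup>2 / (4 * L)"
        using D \<gamma> by auto
      have "0 \<le> min (wt a * G / 2) (G\<^sup>2 / (4 * L))" using G0 \<gamma> L by auto
      then have mono: "logdet_obj A x' \<le> logdet_obj A x" using D(2) by linarith
      have rep': "active_representation P x' S' wt'"
        unfolding x' S' wt' by (rule active_representation_pairwise[OF rep a(1) s(1) \<gamma>])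
      show ?thesis
      proof (cases "\<gamma> = wt a \<and> a \<noteq> s")
        case True
        have "Suc (card S') \<le> card S"
          unfolding S' using True card_Suc_Diff1[OF fin a(1)] by simp
        moreover have "gap_contracts A P \<rho> x x'" if "\<forall>v\<in>S. \<delta> \<le> wt v"
          unfolding gap_contracts_def
        proof (intro allI impI, elim conjE)
          fix e assume e: "\<forall>y\<in>P. pos_def (info_mat A y) \<longrightarrow> e \<le> logdet_obj A y"
            "\<forall>e'. (\<forall>y\<in>P. pos_def (info_mat A y) \<longrightarrow> e' \<le> logdet_obj A y) \<longrightarrow> e' \<le> e"
          define h where "h = logdet_obj A x - e"
          have h: "h \<le> 4 * K * G\<^sup>2" "h \<le> g \<bullet> (x - w)" "0 \<le> h"
            using gap[OF g a w Gs e] by (auto simp: h_def)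
          have "\<rho> * h \<le> \<delta> / 2 * h" using h \<rho> by (intro mult_right_mono) auto
          \<comment> \<open>The selection rule gives
            \<open>h \<le> g \<bullet> (x - w) \<le> G\<close>, so with \<open>wt a\<close> at least
            \<open>\<delta>\<close> even the truncated gain is a fixed fraction of
            \<open>h\<close>.\<close>
          also have "\<dots> \<le> wt a / 2 * G"
            using that a(1) h dir \<delta> by (intro mult_mono) (auto simp: G_def intro: order_trans less_imp_le)
          finally have "\<rho> * h \<le> min (wt a * G / 2) (G\<^sup>2 / (4 * L))"
            using quad_contract[OF h(1,3)] by simp
          moreover have "(1 - \<rho>) * (logdet_obj A x - e) = h - \<rho> * h"
            by (simp add: h_def algebra_simps)
          ultimately show "logdet_obj A x' - e \<le> (1 - \<rho>) * (logdet_obj A x - e)"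
            using D(2) h_def by linarith
        qed
        ultimately show ?thesis using rep' D(1) mono by blast
      next
        case False
        have "gap_contracts A P \<rho> x x'"
          unfolding gap_contracts_def
        proof (intro allI impI, elim conjE)
          fix e assume e: "\<forall>y\<in>P. pos_def (info_mat A y) \<longrightarrow> e \<le> logdet_obj A y"
            "\<forall>e'. (\<forall>y\<in>P. pos_def (info_mat A y) \<longrightarrow> e' \<le> logdet_obj A y) \<longrightarrow> e' \<le> e"
          define h where "h = logdet_obj A x - e"
          have h: "h \<le> 4 * K * G\<^sup>2" "0 \<le> h"
            using gap[OF g a w Gs e] by (auto simp: h_def)
          have "logdet_obj A x' \<le> logdet_obj A x - \<rho> * h"
          proof (cases "a = s")
            case True
            \<comment> \<open>For \<open>a = s\<close> the pairwise gap \<open>G\<close> is 0, so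
              the iterate is already optimal.\<close>
            then have "h = 0" using h by (simp add: G_def)
            then show ?thesis using mono by simp
          next
            case neq: False
            then show ?thesis
              using False \<gamma>(2) D(3) quad_contract[OF h] by (smt (verit))
          qed
          then show "logdet_obj A x' - e \<le> (1 - \<rho>) * (logdet_obj A x - e)"
            by (simp add: h_def algebra_simps)
        qed
        moreover have "card S' \<le> Suc (card S)" unfolding S' using False by auto
        ultimately show ?thesis using rep' D(1) mono by blast
      qed
    next
      case (frank_wolfe g a s w \<gamma>)
      note x' = frank_wolfe(1) and S' = frank_wolfe(2) and wt' = frank_wolfe(3)
      have a: "a \<in> S" "\<forall>v\<in>S. g \<bullet> v \<le> g \<bullet> a" using frank_wolfe(5) by (auto simp: is_arg_max_linorder)
      have s: "s \<in> S" "\<And>v. v \<in> S \<Longrightarrow> g \<bullet> s \<le> g \<bullet> v" using frank_wolfe(6) by (auto simp: is_arg_min_linorder)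
      have w: "w \<in> P" "\<forall>v\<in>P. g \<bullet> w \<le> g \<bullet> v" using frank_wolfe(8) by (auto simp: is_arg_min_linorder)
      note g = frank_wolfe(4) and dir = frank_wolfe(9) and ls = frank_wolfe(10)
      have \<gamma>: "0 \<le> \<gamma>" "\<gamma> \<le> 1" using line_search_range[OF ls] by auto
      define G where "G = g \<bullet> (x - w)"
      have G0: "0 \<le> G" using w xP by (simp add: G_def inner_diff_right)
      have Gs: "g \<bullet> (a - w) \<le> 2 * G"
        using dir active_representation_inner_ge[OF rep s(2)] by (simp add: G_def inner_diff_right)
      have dB: "(\<Sum>i\<in>UNIV. \<bar>(x - w) $ i\<bar>) \<le> 2 * B"
        using w(1) xP B(2) by (intro sum_abs_diff_le) auto
      note D = descends[OF g dB _ ls, folded G_def x', OF G0]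
      have D: "pos_def (info_mat A x')" "logdet_obj A x' \<le> logdet_obj A x - min (G / 2) (G\<^sup>2 / (4 * L))"
        using D by auto
      have "0 \<le> min (G / 2) (G\<^sup>2 / (4 * L))" using G0 L by auto
      then have mono: "logdet_obj A x' \<le> logdet_obj A x" using D(2) by linarith
      have rep': "active_representation P x' S' wt'"
        unfolding x' S' wt' by (rule active_representation_frank_wolfe[OF rep frank_wolfe(7) \<gamma>])
      have "gap_contracts A P \<rho> x x'"
        unfolding gap_contracts_def
      proof (intro allI impI, elim conjE)
        fix e assume e: "\<forall>y\<in>P. pos_def (info_mat A y) \<longrightarrow> e \<le> logdet_obj A y"
          "\<forall>e'. (\<forall>y\<in>P. pos_def (info_mat A y) \<longrightarrow> e' \<le> logdet_obj A y) \<longrightarrow> e' \<le> e"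
        define h where "h = logdet_obj A x - e"
        have h: "h \<le> 4 * K * G\<^sup>2" "h \<le> G" "0 \<le> h"
          using gap[OF g a w(2) Gs e] by (auto simp: h_def G_def)
        have "\<rho> * h \<le> 1 / 2 * G" using h \<rho> by (intro mult_mono) auto
        then have "\<rho> * h \<le> min (G / 2) (G\<^sup>2 / (4 * L))"
          using quad_contract[OF h(1,3)] by simp
        moreover have "(1 - \<rho>) * (logdet_obj A x - e) = h - \<rho> * h"
          by (simp add: h_def algebra_simps)
        ultimately show "logdet_obj A x' - e \<le> (1 - \<rho>) * (logdet_obj A x - e)"
          using D(2) h_def by linarith
      qed
      moreover have "card S' \<le> Suc (card S)"
        unfolding S' using fin by (auto simp: card_insert_if)
      ultimately show ?thesis using rep' D(1) mono by blast
    qed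
  qed
qed

section \<open>Uniform constants and the linear rate\<close>

lemma continuous_on_info_mat [continuous_intros]:
  fixes A :: "real^'n^'m" and f :: "'c::euclidean_space \<Rightarrow> real^'m"
  assumes "continuous_on T f"
  shows "continuous_on T (\<lambda>x. info_mat A (f x))"
  using linear_continuous_on_compose[OF assms linear_info_mat] .

lemma continuous_on_det_info_mat:
  fixes A :: "real^'n^'m"
  shows "continuous_on T (\<lambda>x. det (info_mat A x))"
  unfolding det_def by (intro continuous_intros)

lemma uniform_pos_def:
  fixes A :: "real^'n^'m"
  assumes T: "compact T" and pd: "\<And>x. x \<in> T \<Longrightarrow> pos_def (info_mat A x)"
  shows "\<exists>\<alpha>>0. \<forall>x\<in>T. \<forall>z. \<alpha> * (norm z)\<^sup>2 \<le> z \<bullet> (info_mat A x *v z)"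
proof (cases "T = {}")
  case True
  then show ?thesis by (intro exI[of _ 1]) auto
next
  case False
  have comp: "compact (T \<times> sphere (0::real^'n) 1)"
    using T by (intro compact_Times) auto
  have "(axis k 1 :: real^'n) \<in> sphere 0 1" for k by simp
  then have ne: "T \<times> sphere (0::real^'n) 1 \<noteq> {}" using False by blast
  have cont: "continuous_on (T \<times> sphere (0::real^'n) 1) (\<lambda>p. snd p \<bullet> (info_mat A (fst p) *v snd p))"
    unfolding inner_info_mat matrix_vector_mult_def by (intro continuous_intros)
  obtain p where p: "p \<in> T \<times> sphere (0::real^'n) 1"
    and pmin: "\<And>q. q \<in> T \<times> sphere (0::real^'n) 1 \<Longrightarrow>
      snd p \<bullet> (info_mat A (fst p) *v snd p) \<le> snd q \<bullet> (info_mat A (fst q) *v snd q)"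
    using continuous_attains_inf[OF comp ne cont] by blast
  define \<alpha> where "\<alpha> = snd p \<bullet> (info_mat A (fst p) *v snd p)"
  have "snd p \<noteq> 0" "fst p \<in> T" using p by auto
  then have \<alpha>: "\<alpha> > 0" using pd by (simp add: \<alpha>_def pos_def_def)
  have "\<alpha> * (norm z)\<^sup>2 \<le> z \<bullet> (info_mat A x *v z)" if x: "x \<in> T" for x z
  proof (cases "z = 0")
    case False
    define u where "u = (1 / norm z) *\<^sub>R z"
    have "(x, u) \<in> T \<times> sphere (0::real^'n) 1" using x False by (simp add: u_def)
    then have "\<alpha> \<le> u \<bullet> (info_mat A x *v u)" using pmin[of "(x, u)"] by (simp add: \<alpha>_def)
    also have "\<dots> = (z \<bullet> (info_mat A x *v z)) / (norm z)\<^sup>2"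
      by (simp add: u_def matrix_vector_mult_scaleR power2_eq_square)
    finally show ?thesis using False by (simp add: field_simps)
  qed auto
  then show ?thesis using \<alpha> by blast
qed

text \<open>For nonnegative \<open>x\<close> the form is a sum of nonnegative terms, so a vector on
  which it vanishes lies in the kernel of X(x). Definiteness is thus controlled by the determinant,
  a continuous function of \<open>x\<close>.\<close>

lemma pos_def_info_mat_if_det_nonzero:
  fixes A :: "real^'n^'m"
  assumes x: "\<And>i. 0 \<le> x $ i" and det: "det (info_mat A x) \<noteq> 0"
  shows "pos_def (info_mat A x)"
  unfolding pos_def_def
proof (intro conjI allI impI)
  fix z :: "real^'n" assume z: "z \<noteq> 0"
  have terms: "0 \<le> x $ i * ((A *v z) $ i * (A *v z) $ i)" for i
    using x by simp
  have "z \<bullet> (info_mat A x *v z) \<noteq> 0"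
  proof
    assume "z \<bullet> (info_mat A x *v z) = 0"
    then have "(\<Sum>i\<in>UNIV. x $ i * ((A *v z) $ i * (A *v z) $ i)) = 0"
      by (simp add: inner_info_mat)
    then have "x $ i * ((A *v z) $ i * (A *v z) $ i) = 0" for i
      using terms sum_nonneg_eq_0_iff[of UNIV "\<lambda>i. x $ i * ((A *v z) $ i * (A *v z) $ i)"] by simp
    then have "x $ i * (b * (A *v z) $ i) = 0" for i b
      by (metis mult_eq_0_iff)
    then have "a \<bullet> (info_mat A x *v z) = 0" for a
      unfolding inner_info_mat by (intro sum.neutral) simp
    then have "info_mat A x *v z = 0" by (metis inner_eq_zero_iff)
    moreover have "inj ((*v) (info_mat A x))"
      using det by (simp add: invertible_det_nz[symmetric] inj_matrix_vector_mult)
    ultimately show False using z by (metis injD matrix_vector_mult_0_right)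
  qed
  moreover have "0 \<le> z \<bullet> (info_mat A x *v z)"
    unfolding inner_info_mat using terms by (intro sum_nonneg) auto
  ultimately show "0 < z \<bullet> (info_mat A x *v z)" by simp
qed simp

lemma inner_info_mat_mono:
  assumes "\<And>i. x $ i \<le> y $ i"
  shows "z \<bullet> (info_mat A x *v z) \<le> z \<bullet> (info_mat A y *v z)"
  unfolding inner_info_mat using assms by (intro sum_mono mult_right_mono) auto

text \<open>Let \<open>y\<close> be the plain sum of the active vertices. Entrywise,
  \<open>x\<close> lies between \<open>\<delta> *\<^sub>R y\<close> and \<open>y\<close>, and the
  form of X is monotone in this order: \<open>y\<close> inherits definiteness from \<open>x\<close>,
  and \<open>x\<close> inherits \<open>\<delta>\<close> times the bound for \<open>y\<close>. Only
  finitely many \<open>y\<close> occur.\<close>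

lemma uniform_lower_bound_on_starts:
  fixes A :: "real^'n^'m"
  assumes P: "polytope P" and nn: "\<And>x i. x \<in> P \<Longrightarrow> 0 \<le> x $ i" and \<delta>: "0 < \<delta>"
  shows "\<exists>\<alpha>>0. \<forall>x S wt. bpcg_start A P (x, S, wt) \<longrightarrow> (\<forall>v\<in>S. \<delta> \<le> wt v) \<longrightarrow>
    (\<forall>z. \<alpha> * (norm z)\<^sup>2 \<le> z \<bullet> (info_mat A x *v z))"
proof -
  define V where "V = {v. v extreme_point_of P}"
  have VP: "V \<subseteq> P" by (auto simp: V_def extreme_point_of_def)
  have fV: "finite V"
    unfolding V_def using P by (intro finite_polyhedron_extreme_points polytope_imp_polyhedron)
  define T where "T = {y \<in> (\<lambda>S. \<Sum>v\<in>S. v) ` Pow V. pos_def (info_mat A y)}"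
  have "finite T" unfolding T_def using fV by auto
  then have "compact T" by (rule finite_imp_compact)
  moreover have "pos_def (info_mat A y)" if "y \<in> T" for y
    using that by (simp add: T_def)
  ultimately obtain \<alpha> where \<alpha>: "\<alpha> > 0" "\<forall>x\<in>T. \<forall>z. \<alpha> * (norm z)\<^sup>2 \<le> z \<bullet> (info_mat A x *v z)"
    using uniform_pos_def by blast
  show ?thesis
  proof (rule exI[of _ "\<delta> * \<alpha>"], rule conjI, goal_cases)
    case 1
    show ?case using \<alpha> \<delta> by simp
  next
    case 2
    show ?case
    proof (intro allI impI)
      fix x S wt and z :: "real^'n"
      assume start: "bpcg_start A P (x, S, wt)" and wt: "\<forall>v\<in>S. \<delta> \<le> wt v"
      have fin: "finite S" and SV: "S \<subseteq> V" and sum1: "(\<Sum>v\<in>S. wt v) = 1" and x: "x = (\<Sum>v\<in>S. wt v *\<^sub>R v)"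
        and pos: "\<And>v. v \<in> S \<Longrightarrow> 0 < wt v" and pd: "pos_def (info_mat A x)"
        using start by (auto simp: bpcg_start_def V_def domain_feasible_def)
      have Snn: "0 \<le> v $ i" if "v \<in> S" for v i using that SV VP nn by blast
      have wt1: "wt v \<le> 1" if "v \<in> S" for v
        using member_le_sum[of v S wt] that fin pos sum1 by (auto intro: less_imp_le)
      define y where "y = (\<Sum>v\<in>S. v)"
      have le: "x $ i \<le> y $ i" for i
        unfolding x y_def sum_component
        using Snn wt1 by (intro sum_mono) (auto intro: mult_left_le_one_le less_imp_le[OF pos])
      have ge: "(\<delta> *\<^sub>R y) $ i \<le> x $ i" for i
        unfolding x y_def scaleR_sum_right sum_component
        using Snn wt by (intro sum_mono) (auto intro: mult_right_mono)
      have "pos_def (info_mat A y)"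
        unfolding pos_def_def
      proof (intro conjI allI impI)
        fix z :: "real^'n" assume "z \<noteq> 0"
        then show "0 < z \<bullet> (info_mat A y *v z)"
          using pd inner_info_mat_mono[of x y, OF le] by (fastforce simp: pos_def_def intro: less_le_trans)
      qed simp
      then have "y \<in> T" unfolding T_def y_def using SV by auto
      then have "\<delta> * \<alpha> * (norm z)\<^sup>2 \<le> \<delta> * (z \<bullet> (info_mat A y *v z))"
        using \<alpha>(2)[rule_format, of y z] \<delta> by (simp add: mult.assoc)
      also have "\<dots> = z \<bullet> (info_mat A (\<delta> *\<^sub>R y) *v z)"
        by (simp add: inner_info_mat sum_distrib_left mult.assoc)
      also have "\<dots> \<le> z \<bullet> (info_mat A x *v z)"
        by (rule inner_info_mat_mono[OF ge])
      finally show "\<delta> * \<alpha> * (norm z)\<^sup>2 \<le> z \<bullet> (info_mat A x *v z)" .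
    qed
  qed
qed

text \<open>A bound on the form does not pass to points of lower objective value, but a bound on the
  determinant does. So the bound for the starts is turned into a determinant bound on the compact
  set \<open>T0\<close>, passed on by descent, and turned back into a bound on the form on the
  compact set \<open>T1\<close>.\<close>

lemma uniform_lower_bound_on_sublevels:
  fixes A :: "real^'n^'m"
  assumes P: "polytope P" and nn: "\<And>x i. x \<in> P \<Longrightarrow> 0 \<le> x $ i" and \<delta>: "0 < \<delta>"
  shows "\<exists>\<alpha>>0. \<forall>x0 S wt. bpcg_start A P (x0, S, wt) \<longrightarrow> (\<forall>v\<in>S. \<delta> \<le> wt v) \<longrightarrow>
    (\<forall>x\<in>P. pos_def (info_mat A x) \<longrightarrow> logdet_obj A x \<le> logdet_obj A x0 \<longrightarrow>
      (\<forall>z. \<alpha> * (norm z)\<^sup>2 \<le> z \<bullet> (info_mat A x *v z)))"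
proof -
  obtain \<alpha>0 where \<alpha>0: "\<alpha>0 > 0" "\<And>x S wt. bpcg_start A P (x, S, wt) \<Longrightarrow> (\<forall>v\<in>S. \<delta> \<le> wt v) \<Longrightarrow>
    (\<forall>z. \<alpha>0 * (norm z)\<^sup>2 \<le> z \<bullet> (info_mat A x *v z))"
    using uniform_lower_bound_on_starts[OF P nn \<delta>, of A] by metis
  have cP: "compact P" using P by (rule polytope_imp_compact)
  define T0 where "T0 = P \<inter> (\<Inter>z. {x. \<alpha>0 * (norm z)\<^sup>2 \<le> z \<bullet> (info_mat A x *v z)})"
  have "compact T0"
    unfolding T0_def inner_info_mat
    by (intro compact_Int_closed cP closed_INT ballI closed_Collect_le continuous_intros)
  have pd0: "pos_def (info_mat A x)" if "x \<in> T0" for x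
    unfolding pos_def_def
  proof (intro conjI allI impI)
    fix z :: "real^'n" assume "z \<noteq> 0"
    then have "0 < \<alpha>0 * (norm z)\<^sup>2" using \<alpha>0 by simp
    also have "\<dots> \<le> z \<bullet> (info_mat A x *v z)" using that by (auto simp: T0_def)
    finally show "0 < z \<bullet> (info_mat A x *v z)" .
  qed simp
  obtain \<epsilon> where \<epsilon>: "\<epsilon> > 0" "\<And>x. x \<in> T0 \<Longrightarrow> \<epsilon> \<le> det (info_mat A x)"
  proof (cases "T0 = {}")
    case True
    then show ?thesis using that[of 1] by simp
  next
    case False
    then obtain x1 where "x1 \<in> T0" "\<And>x. x \<in> T0 \<Longrightarrow> det (info_mat A x1) \<le> det (info_mat A x)"
      using continuous_attains_inf[OF \<open>compact T0\<close> _ continuous_on_det_info_mat] by blast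
    then show ?thesis using that[of "det (info_mat A x1)"] pos_def_det_pos pd0 by blast
  qed
  define T1 where "T1 = P \<inter> {x. \<epsilon> \<le> det (info_mat A x)}"
  have "compact T1"
    unfolding T1_def by (intro compact_Int_closed cP closed_Collect_le continuous_intros continuous_on_det_info_mat)
  moreover have "pos_def (info_mat A x)" if "x \<in> T1" for x
    using that nn \<epsilon>(1) by (intro pos_def_info_mat_if_det_nonzero) (auto simp: T1_def)
  ultimately obtain \<alpha> where \<alpha>: "\<alpha> > 0" "\<forall>x\<in>T1. \<forall>z. \<alpha> * (norm z)\<^sup>2 \<le> z \<bullet> (info_mat A x *v z)"
    using uniform_pos_def by blast
  have "\<alpha> * (norm z)\<^sup>2 \<le> z \<bullet> (info_mat A x *v z)"
    if start: "bpcg_start A P (x0, S, wt)" "\<forall>v\<in>S. \<delta> \<le> wt v"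
      and x: "x \<in> P" "pos_def (info_mat A x)" "logdet_obj A x \<le> logdet_obj A x0" for x0 S wt x z
  proof -
    have x0: "x0 \<in> P" "pos_def (info_mat A x0)" using start(1) by (auto simp: bpcg_start_def domain_feasible_def)
    then have "x0 \<in> T0" using \<alpha>0(2)[OF start] by (simp add: T0_def)
    then have "\<epsilon> \<le> det (info_mat A x0)" by (rule \<epsilon>(2))
    also have "\<dots> \<le> det (info_mat A x)"
      using x(3) pos_def_det_pos[OF x(2)] pos_def_det_pos[OF x0(2)] by (simp add: logdet_obj_def)
    finally have "x \<in> T1" using x(1) by (simp add: T1_def)
    then show ?thesis using \<alpha>(2) by blast
  qed
  then show ?thesis using \<alpha>(1) by blast
qed

section \<open>From contraction counts to the linear rate\<close>

lemma linear_rate_from_contraction_count: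
  fixes h :: "nat \<Rightarrow> real" and n :: "nat \<Rightarrow> nat"
  assumes q: "0 < q" "q < 1" and h0: "\<And>t. 0 \<le> h t" and mono: "\<And>t. h (Suc t) \<le> h t"
    and first: "h 1 \<le> q * h 0" and n0: "n 0 \<le> k"
    and step: "\<And>t. n (Suc t) \<le> Suc (n t) \<and> h (Suc t) \<le> q * h t \<or> Suc (n (Suc t)) \<le> n t"
  shows "h t \<le> h 0 * exp (- (- ln q / (real k + 2)) * real t)"
proof -
  \<comment> \<open>\<open>b\<close> counts contracting steps. Such a step raises
    \<open>n t + t\<close> by at most 2 and \<open>2 * b\<close> by exactly 2; any other step lowers
    \<open>n t\<close> and so does not raise \<open>n t + t\<close>.\<close>
  have count: "\<exists>b. n t + t \<le> k + 2 * b \<and> h t \<le> q ^ b * h 0" for t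
  proof (induction t)
    case 0
    show ?case using n0 by (intro exI[of _ 0]) simp
  next
    case (Suc t)
    then obtain b where b: "n t + t \<le> k + 2 * b" "h t \<le> q ^ b * h 0" by blast
    show ?case
    proof (cases "n (Suc t) \<le> Suc (n t) \<and> h (Suc t) \<le> q * h t")
      case True
      then have "h (Suc t) \<le> q * (q ^ b * h 0)"
        using b(2) q by (meson mult_left_mono order_trans less_imp_le)
      then show ?thesis using True b(1) by (intro exI[of _ "Suc b"]) (auto simp: mult.assoc)
    next
      case False
      then show ?thesis using step[of t] b mono[of t] by (intro exI[of _ b]) auto
    qed
  qed
  have first': "h t \<le> q * h 0" if "1 \<le> t" for t
    using lift_Suc_antimono_le[of h, OF mono that] first by simp
  obtain b where b: "n t + t \<le> k + 2 * b" "h t \<le> q ^ b * h 0" using count by blast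
  have powr: "exp (- (- ln q / (real k + 2)) * real t) = q powr (real t / (real k + 2))"
    using q by (simp add: powr_def)
  have conclude: ?thesis if "h t \<le> q ^ j * h 0" "real t \<le> real j * (real k + 2)" for j
  proof -
    have "real t / (real k + 2) \<le> real j" using that(2) by (simp add: field_simps)
    then have "q powr real j \<le> q powr (real t / (real k + 2))" using q by (intro powr_mono') auto
    then have "q ^ j \<le> q powr (real t / (real k + 2))" using q by (simp add: powr_realpow)
    then show ?thesis unfolding powr using that(1) h0[of 0]
      by (metis mult.commute mult_right_mono order_trans)
  qed
  \<comment> \<open>Up to time \<open>k + 2\<close> the count may give nothing, but there the
    exponent \<open>t / (k + 2)\<close> is at most 1 and the single contraction in
    \<open>first\<close> suffices. Later the count gives \<open>t - k \<le> 2 * b\<close>, and for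
    \<open>t > k + 2\<close> this implies \<open>t \<le> b * (k + 2)\<close>.\<close>
  consider "t = 0" | "1 \<le> t" "t \<le> k + 2" | "k + 2 < t" by linarith
  then show ?thesis
  proof cases
    case 1
    then show ?thesis by simp
  next
    case 2
    then show ?thesis using first' by (intro conclude[of 1]) auto
  next
    case 3
    then obtain d where d: "t = k + 2 + d" using less_imp_add_positive by blast
    have "d + 2 \<le> 2 * b" using b(1) d by simp
    then have "d * k + 2 * k + 2 * d + 4 \<le> 2 * b * (k + 2)"
      using mult_right_mono[of "d + 2" "2 * b" "k + 2"] by (simp add: algebra_simps)
    moreover have "2 * t \<le> d * k + 2 * k + 2 * d + 4" using d by simp
    ultimately have "t \<le> b * (k + 2)" by simp
    then have "real t \<le> real b * (real k + 2)" by (metis of_nat_add of_nat_le_iff of_nat_mult of_nat_numeral)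
    then show ?thesis using conclude[OF b(2)] by simp
  qed
qed

lemma polytope_design_polytope: "polytope (design_polytope l u N)"
proof -
  have "design_polytope l u N = cbox (\<chi> i. real (l $ i)) (\<chi> i. real (u $ i)) \<inter> {x. (\<chi> i. 1) \<bullet> x = real N}"
    by (auto simp: design_polytope_def inner_vec_def mem_box_cart) (meson of_nat_0_le_iff order_trans)
  then show ?thesis
    by (simp add: polytope_Int_polyhedron polytope_interval polyhedron_hyperplane)
qed

text \<open>The feasible \<open>x\<close> excludes the infimum \<infinity> and \<open>b\<close>
  excludes -\<infinity>, so the extended gap is a difference of reals. The first two properties have
  the form that \<open>gap_contracts\<close> expects.\<close>

lemma primal_gap_eq:
  fixes A :: "real^'n^'m"
  assumes x: "x \<in> P" "pos_def (info_mat A x)"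
    and bdd: "\<And>y. y \<in> P \<Longrightarrow> pos_def (info_mat A y) \<Longrightarrow> b \<le> logdet_obj A y"
  obtains e where "\<forall>y\<in>P. pos_def (info_mat A y) \<longrightarrow> e \<le> logdet_obj A y"
    "\<forall>e'. (\<forall>y\<in>P. pos_def (info_mat A y) \<longrightarrow> e' \<le> logdet_obj A y) \<longrightarrow> e' \<le> e"
    "\<And>x. pos_def (info_mat A x) \<Longrightarrow> primal_gap A P x = ereal (logdet_obj A x - e)"
proof -
  define I where "I = (INF y\<in>P. dopt_obj A y)"
  have "I \<le> dopt_obj A x" unfolding I_def using x by (intro INF_lower)
  then have "I \<noteq> \<infinity>" using x by (auto simp: dopt_obj_def)
  moreover have ge: "ereal b' \<le> I" if "\<forall>y\<in>P. pos_def (info_mat A y) \<longrightarrow> b' \<le> logdet_obj A y" for b'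
    unfolding I_def using that by (intro INF_greatest) (auto simp: dopt_obj_def)
  have "I \<noteq> - \<infinity>" using ge[of b] bdd by auto
  ultimately obtain e where e: "I = ereal e" by (cases I) auto
  show thesis
  proof (rule that[of e])
    show "\<forall>y\<in>P. pos_def (info_mat A y) \<longrightarrow> e \<le> logdet_obj A y"
    proof (intro ballI impI)
      fix y assume y: "y \<in> P" "pos_def (info_mat A y)"
      have "I \<le> dopt_obj A y" unfolding I_def using y by (intro INF_lower)
      then show "e \<le> logdet_obj A y" using y by (simp add: dopt_obj_def e)
    qed
    show "\<forall>e'. (\<forall>y\<in>P. pos_def (info_mat A y) \<longrightarrow> e' \<le> logdet_obj A y) \<longrightarrow> e' \<le> e"
      using ge by (simp add: e)
    show "primal_gap A P x = ereal (logdet_obj A x - e)" if "pos_def (info_mat A x)" for x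
      using that unfolding primal_gap_def I_def[symmetric] by (simp add: dopt_obj_def e)
  qed
qed

lemma bpcg_step_gradient:
  assumes "bpcg_step A P (x, S, wt) s'"
  obtains g w where "GDERIV (logdet_obj A) x :> g" "\<forall>v\<in>P. g \<bullet> w \<le> g \<bullet> v"
  using assms by cases (auto simp: is_arg_min_linorder)

theorem propositionC6:
  fixes A :: "real^'n^'m" and l u :: "nat^'m" and N :: nat
  assumes "rank A = CARD('n)"
    and "\<forall>i. l $ i \<le> u $ i"
    and "0 < N"
  defines "P \<equiv> design_polytope l u N"
  shows "\<forall>\<delta>>0. \<exists>c>0. \<forall>x S wt.
           bpcg_run A P x S wt \<and> (\<forall>v\<in>S 0. \<delta> \<le> wt 0 v) \<longrightarrow>
           (\<forall>t. primal_gap A P (x t) \<le> primal_gap A P (x 0) * ereal (exp (- c * real t)))"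
proof (intro allI impI)
  fix \<delta> :: real assume \<delta>: "0 < \<delta>"
  have P: "polytope P" unfolding P_def by (rule polytope_design_polytope)
  have nn: "0 \<le> y $ i" if "y \<in> P" for y i using that by (simp add: P_def design_polytope_def)
  have l1: "(\<Sum>i\<in>UNIV. \<bar>y $ i\<bar>) \<le> real N" if "y \<in> P" for y
    using that nn[OF that] by (simp add: P_def design_polytope_def)
  obtain \<alpha> where \<alpha>: "\<alpha> > 0" and sub: "\<And>x0 S wt x. bpcg_start A P (x0, S, wt) \<Longrightarrow> (\<forall>v\<in>S. \<delta> \<le> wt v) \<Longrightarrow>
    x \<in> P \<Longrightarrow> pos_def (info_mat A x) \<Longrightarrow> logdet_obj A x \<le> logdet_obj A x0 \<Longrightarrow>
      (\<forall>z. \<alpha> * (norm z)\<^sup>2 \<le> z \<bullet> (info_mat A x *v z))"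
    using uniform_lower_bound_on_sublevels[OF P nn \<delta>, of A] by metis
  have N0: "0 \<le> real N" by simp
  obtain \<rho> where \<rho>: "\<rho> > 0" "\<rho> < 1" and contract: "\<And>x S wt x' S' wt'. bpcg_step A P (x, S, wt) (x', S', wt') \<Longrightarrow>
    active_representation P x S wt \<Longrightarrow> pos_def (info_mat A x) \<Longrightarrow>
    (\<forall>z. \<alpha> * (norm z)\<^sup>2 \<le> z \<bullet> (info_mat A x *v z)) \<Longrightarrow>
    active_representation P x' S' wt' \<and> pos_def (info_mat A x') \<and> logdet_obj A x' \<le> logdet_obj A x \<and>
    (card S' \<le> Suc (card S) \<and> gap_contracts A P \<rho> x x' \<or>
     Suc (card S') \<le> card S \<and> ((\<forall>v\<in>S. \<delta> \<le> wt v) \<longrightarrow> gap_contracts A P \<rho> x x'))"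
    using bpcg_step_contracts[OF P N0 l1 \<alpha> \<delta>, of A] by metis
  define V where "V = {v. v extreme_point_of P}"
  have fV: "finite V"
    unfolding V_def using P by (intro finite_polyhedron_extreme_points polytope_imp_polyhedron)
  \<comment> \<open>One factor \<open>1 - \<rho>\<close> is spread over \<open>card V + 2\<close>
    steps; \<open>card V\<close> bounds the size of the initial active set.\<close>
  define c where "c = - ln (1 - \<rho>) / (real (card V) + 2)"
  have c: "c > 0" unfolding c_def using \<rho> by (intro divide_pos_pos) auto
  show "\<exists>c>0. \<forall>x S wt. bpcg_run A P x S wt \<and> (\<forall>v\<in>S 0. \<delta> \<le> wt 0 v) \<longrightarrow>
           (\<forall>t. primal_gap A P (x t) \<le> primal_gap A P (x 0) * ereal (exp (- c * real t)))"
  proof (rule exI[of _ c], rule conjI[OF c], intro allI impI, elim conjE)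
    fix x S wt t
    assume run: "bpcg_run A P x S wt" and wt: "\<forall>v\<in>S 0. \<delta> \<le> wt 0 v"
    have start: "bpcg_start A P (x 0, S 0, wt 0)"
      and step: "\<And>t. bpcg_step A P (x t, S t, wt t) (x (Suc t), S (Suc t), wt (Suc t))"
      using run by (auto simp: bpcg_run_def)
    have rep0: "active_representation P (x 0) (S 0) (wt 0)"
      using start by (auto simp: bpcg_start_def active_representation_def intro: less_imp_le)
    have x0: "x 0 \<in> P" "pos_def (info_mat A (x 0))"
      using start by (auto simp: bpcg_start_def domain_feasible_def)
    \<comment> \<open>The bound \<open>\<alpha>\<close> holds on the sublevel set of the start, and
      the step estimate that yields descent presupposes \<open>\<alpha>\<close>; so both are carried
      along in one induction.\<close>
    have inv: "active_representation P (x t) (S t) (wt t) \<and> pos_def (info_mat A (x t)) \<and>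
      logdet_obj A (x t) \<le> logdet_obj A (x 0)" for t
    proof (induction t)
      case 0
      show ?case using rep0 x0 by simp
    next
      case (Suc t)
      then have "x t \<in> P" using active_representation_mem[OF polytope_imp_convex[OF P]] by blast
      then show ?case
        using contract[OF step[of t]] sub[OF start wt] Suc by (meson order_trans)
    qed
    have xP: "x t \<in> P" for t using active_representation_mem[OF polytope_imp_convex[OF P]] inv by blast
    note cs = contract[OF step inv[THEN conjunct1] inv[THEN conjunct2, THEN conjunct1]
        sub[OF start wt xP inv[THEN conjunct2, THEN conjunct1] inv[THEN conjunct2, THEN conjunct2]]]
    obtain g w where g: "GDERIV (logdet_obj A) (x 0) :> g" and w: "\<forall>v\<in>P. g \<bullet> w \<le> g \<bullet> v"
      using bpcg_step_gradient[OF step] .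
    \<comment> \<open>The tangent at the start, minimized over \<open>P\<close> at \<open>w\<close>,
      bounds the objective from below and makes the infimum finite.\<close>
    have "logdet_obj A (x 0) - g \<bullet> (x 0 - w) \<le> logdet_obj A y" if "y \<in> P" "pos_def (info_mat A y)" for y
      using logdet_above_tangent[OF g x0(2) that(2)] w that(1) by (fastforce simp: inner_diff_right)
    then obtain e where e: "\<forall>y\<in>P. pos_def (info_mat A y) \<longrightarrow> e \<le> logdet_obj A y"
      "\<forall>e'. (\<forall>y\<in>P. pos_def (info_mat A y) \<longrightarrow> e' \<le> logdet_obj A y) \<longrightarrow> e' \<le> e"
      and gap: "\<And>x. pos_def (info_mat A x) \<Longrightarrow> primal_gap A P x = ereal (logdet_obj A x - e)"
      using primal_gap_eq[OF x0] by metis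
    define h where "h t = logdet_obj A (x t) - e" for t
    have contracts: "h (Suc t) \<le> (1 - \<rho>) * h t" if "gap_contracts A P \<rho> (x t) (x (Suc t))" for t
      using that e unfolding gap_contracts_def h_def by blast
    have "h t \<le> h 0 * exp (- (- ln (1 - \<rho>) / (real (card V) + 2)) * real t)"
    proof (rule linear_rate_from_contraction_count[where n = "\<lambda>t. card (S t)"])
      show "0 \<le> h t" for t using e(1) xP inv by (simp add: h_def)
      show "h (Suc t) \<le> h t" for t using cs[of t] by (simp add: h_def)
      \<comment> \<open>Both alternatives of the step estimate contract here, the second because the
        initial weights are at least \<open>\<delta>\<close>.\<close>
      show "h 1 \<le> (1 - \<rho>) * h 0" using cs[of 0] wt contracts[of 0] by auto
      show "card (S 0) \<le> card V"
        using rep0 fV by (intro card_mono) (auto simp: active_representation_def V_def)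
      show "card (S (Suc t)) \<le> Suc (card (S t)) \<and> h (Suc t) \<le> (1 - \<rho>) * h t \<or> Suc (card (S (Suc t))) \<le> card (S t)" for t
        using cs[of t] contracts[of t] by blast
    qed (use \<rho> in auto)
    then show "primal_gap A P (x t) \<le> primal_gap A P (x 0) * ereal (exp (- c * real t))"
      using inv by (simp add: gap h_def c_def)
  qed
qed

end
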